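(* Let $P=\prod_{i=1}^mp_i$ be (a family, $m\to\infty$, of) product distributions with all $p_i(a)>0$ and $\mathrm{Var}_U(S)>0$. Assume: $\sqrt m\,\eta\le\varepsilon_0$ for a fixed small constant $\varepsilon_0$; the lattice-span condition $\inf_{\tau\in[-1,0]}\Lambda_\eta(\tau)\ge\lambda m$ for a constant $\lambda>0$; the entropy gap $\bar H_{1/(1+\rho)}-\bar H_1\ge g>0$ for $\rho\in[\tfrac12,1]$; $\log(1+\ln N)=o(m)$; and $\sup_{\tau\in[-1,0]}\sqrt{2\pi}\,\varepsilon_\tau\le c_0<1$. Then $$|s_\eta-s|\ \le\ \frac{2+s}{\bar H_{2/3}}\,\eta\,(1+\varepsilon_m),$$ where $\varepsilon_m$ reduces to computed scalars with absolute constants by $$\varepsilon_m\le2\sqrt{2\pi}\,\varepsilon_\tau\big(1+O(\varepsilon_\tau)\big)+\bar z^{-2}+O(\eta)+O\big(\log(1+\ln N)/f_\eta(\tfrac12)\big).$$ If moreover the alphabets are uniformly bounded, $\max_as_i(a)-\min_as_i(a)\le c$ for all $i$, $R=\sum_i(\max_as_i(a)-\min_as_i(a))=\Theta(m)$ and $\log(1/\eta)=o(m)$, then $\varepsilon_m=O(m^{-1/2})$.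
   Context: Setting. $K=\prod_{i=1}^mA_i$ finite, $N=|K|$; $P=\prod_ip_i$; $U$ uniform on $K$; $s_i(a)=-\ln p_i(a)$; $S(x)=\sum_is_i(x_i)$. $f(\rho)=\ln\mathbb{E}_P[G^\rho]$ for a bijection $G:K\to\{1,\dots,N\}$ enumerating keys by non-decreasing $S$ (value independent of tie-breaking); $s=f(1)/f(\tfrac12)$. $H_\alpha(p)=\frac1{1-\alpha}\ln\sum_ap(a)^\alpha$ ($H_1$ Shannon entropy, nats), $\bar H_\alpha=\frac1m\sum_iH_\alpha(p_i)$, $H=\mathbb{E}_P[S]$. Binned estimator. $\widetilde s_i(a)=\eta(\lfloor s_i(a)/\eta\rfloor+1)$, $\widetilde S(x)=\sum_i\widetilde s_i(x_i)$, $\widetilde\pi(t)=\mathbb{P}_P[\widetilde S=t]$, $\widetilde\nu(t)=\mathbb{P}_U[\widetilde S=t]$, $\widetilde F(t)=\mathbb{P}_U[\widetilde S\le t]$, $\widetilde F(t^-)=\mathbb{P}_U[\widetilde S<t]$, $\widetilde{\mathcal A}_\rho(t)=\frac1{N\widetilde\nu(t)}\sum_{r=N\widetilde F(t^-)+1}^{N\widetilde F(t)}r^\rho$, $f_\eta(\rho)=\ln\sum_t\widetilde\pi(t)\widetilde{\mathcal A}_\rho(t)$, $s_\eta=f_\eta(1)/f_\eta(\tfrac12)$. Saddle quantities. $\Lambda_U(\tau)=\ln\mathbb{E}_U[e^{\tau S}]$; $\tau_t$ solves $\Lambda_U'(\tau_t)=t$; $\sigma_t^2=\Lambda_U''(\tau_t)$;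 $z_t=|\tau_t|\sigma_t$; $\bar z^{-2}=\sup\{z_t^{-2}:t\ge H,\ |\tau_t|\ge\tau_0\}$ for a fixed threshold $\tau_0>0$ delimiting the saddle range $|\tau_t|=\Theta(1)$. Local-CLT scalars. $U_\tau$ is the product law with $U_\tau^{(i)}(a)\propto e^{\tau s_i(a)}$. For $\tau\in[-1,0]$ let $X\sim U_\tau$, $Y_i=\widetilde s_i(X_i)$, $\varsigma_i^2=\mathrm{Var}(Y_i)$, $\varsigma_\tau^2=\sum_i\varsigma_i^2$, $\beta_\tau=\sum_i\mathbb{E}|Y_i-\mathbb{E}Y_i|^3$, $\psi_i(t)=\mathbb{E}e^{\mathrm{i}t(Y_i-\mathbb{E}Y_i)}$, $Q(t)=\sum_i|\psi_i(t)-1|^2$, $\delta_1=\min\{3\varsigma_\tau^2/(2\beta_\tau),1/\max_i\varsigma_i\}$, $$\Lambda_\eta(\tau)=\min_{\delta_1\le|t|\le\pi/\eta}\sum_i\sum_{a<b}4\,U_\tau^{(i)}(a)U_\tau^{(i)}(b)\sin^2\big(t(\widetilde s_i(a)-\widetilde s_i(b))/2\big)$$ ($+\infty$ if $\delta_1\ge\pi/\eta$), $q_\tau=\frac{\varsigma_\tau}{2\pi}\int_{|t|\le\delta_1}\big[\frac{\beta_\tau|t|^3}6(e^{Q(t)}-1)+Q(t)e^{Q(t)}\big]e^{-\varsigma_\tau^2t^2/4}dt$, and $$\varepsilon_\tau=\frac4{3\pi}\frac{\beta_\tau}{\varsigma_\tau^3}+q_\tau+\frac{\varsigma_\tau}\eta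 e^{-\Lambda_\eta(\tau)/2}+\sqrt{\tfrac2\pi}\,\bar\Phi(\varsigma_\tau\delta_1),$$ $\bar\Phi$ the standard normal upper tail. In the bound on $\varepsilon_m$, $\varepsilon_\tau$ is to be read as its supremum over the tilt range $[-1,0]$. *)

theory Defs
  imports "HOL-Probability.Probability" "HOL-Library.Landau_Symbols"
begin

text \<open>
  An instance is given by the number of coordinates \<open>m\<close>, alphabets \<open>A i\<close> and letter laws \<open>p i\<close>
  for \<open>i = 1, \<dots>, m\<close>, and (for the binned estimator) a bin width \<open>\<eta>\<close>.
  A key is a function on \<open>{1..m}\<close> extended by \<open>undefined\<close>; this is the convention of \<open>PiE\<close>, and
  the default value passed to \<open>Pi_pmf\<close> matches it.
\<close>

definition keys :: "nat \<Rightarrow> (nat \<Rightarrow> 'a set) \<Rightarrow> (nat \<Rightarrow> 'a) set" where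
  "keys m A = PiE {1..m} A"

definition key_law :: "nat \<Rightarrow> (nat \<Rightarrow> 'a pmf) \<Rightarrow> (nat \<Rightarrow> 'a) pmf" where
  "key_law m p = Pi_pmf {1..m} undefined p"

definition key_unif :: "nat \<Rightarrow> (nat \<Rightarrow> 'a set) \<Rightarrow> (nat \<Rightarrow> 'a) pmf" where
  "key_unif m A = pmf_of_set (keys m A)"

definition surprisal :: "(nat \<Rightarrow> 'a pmf) \<Rightarrow> nat \<Rightarrow> 'a \<Rightarrow> real" where
  "surprisal p i a = - ln (pmf (p i) a)"

definition total_surprisal :: "nat \<Rightarrow> (nat \<Rightarrow> 'a pmf) \<Rightarrow> (nat \<Rightarrow> 'a) \<Rightarrow> real" where
  "total_surprisal m p x = (\<Sum>i=1..m. surprisal p i (x i))"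


subsection \<open>Guessing moments and entropies\<close>

definition guess_order :: "nat \<Rightarrow> (nat \<Rightarrow> 'a set) \<Rightarrow> (nat \<Rightarrow> 'a pmf) \<Rightarrow> ((nat \<Rightarrow> 'a) \<Rightarrow> nat) \<Rightarrow> bool" where
  "guess_order m A p G \<longleftrightarrow>
     bij_betw G (keys m A) {1..card (keys m A)} \<and>
     (\<forall>x\<in>keys m A. \<forall>y\<in>keys m A. G x \<le> G y \<longrightarrow> total_surprisal m p x \<le> total_surprisal m p y)"

definition guess_f :: "nat \<Rightarrow> (nat \<Rightarrow> 'a pmf) \<Rightarrow> ((nat \<Rightarrow> 'a) \<Rightarrow> nat) \<Rightarrow> real \<Rightarrow> real" where
  "guess_f m p G \<rho> = ln (measure_pmf.expectation (key_law m p) (\<lambda>x. real (G x) powr \<rho>))"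

definition guess_s :: "nat \<Rightarrow> (nat \<Rightarrow> 'a pmf) \<Rightarrow> ((nat \<Rightarrow> 'a) \<Rightarrow> nat) \<Rightarrow> real" where
  "guess_s m p G = guess_f m p G 1 / guess_f m p G (1/2)"

definition renyi :: "'a set \<Rightarrow> 'a pmf \<Rightarrow> real \<Rightarrow> real" where
  "renyi B q \<alpha> =
     (if \<alpha> = 1 then - (\<Sum>a\<in>B. pmf q a * ln (pmf q a))
      else 1 / (1 - \<alpha>) * ln (\<Sum>a\<in>B. pmf q a powr \<alpha>))"

definition mean_renyi :: "nat \<Rightarrow> (nat \<Rightarrow> 'a set) \<Rightarrow> (nat \<Rightarrow> 'a pmf) \<Rightarrow> real \<Rightarrow> real" where
  "mean_renyi m A p \<alpha> = 1 / real m * (\<Sum>i=1..m. renyi (A i) (p i) \<alpha>)"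

definition mean_surprisal :: "nat \<Rightarrow> (nat \<Rightarrow> 'a pmf) \<Rightarrow> real" where
  "mean_surprisal m p = measure_pmf.expectation (key_law m p) (total_surprisal m p)"


subsection \<open>The binned estimator\<close>

definition binned_surprisal :: "(nat \<Rightarrow> 'a pmf) \<Rightarrow> real \<Rightarrow> nat \<Rightarrow> 'a \<Rightarrow> real" where
  "binned_surprisal p \<eta> i a = \<eta> * (real_of_int \<lfloor>surprisal p i a / \<eta>\<rfloor> + 1)"

definition total_binned :: "nat \<Rightarrow> (nat \<Rightarrow> 'a pmf) \<Rightarrow> real \<Rightarrow> (nat \<Rightarrow> 'a) \<Rightarrow> real" where
  "total_binned m p \<eta> x = (\<Sum>i=1..m. binned_surprisal p \<eta> i (x i))"

definition bin_pi :: "nat \<Rightarrow> (nat \<Rightarrow> 'a pmf) \<Rightarrow> real \<Rightarrow> real \<Rightarrow> real" where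
  "bin_pi m p \<eta> t = measure_pmf.prob (key_law m p) {x. total_binned m p \<eta> x = t}"

definition bin_nu :: "nat \<Rightarrow> (nat \<Rightarrow> 'a set) \<Rightarrow> (nat \<Rightarrow> 'a pmf) \<Rightarrow> real \<Rightarrow> real \<Rightarrow> real" where
  "bin_nu m A p \<eta> t = measure_pmf.prob (key_unif m A) {x. total_binned m p \<eta> x = t}"

definition bin_F :: "nat \<Rightarrow> (nat \<Rightarrow> 'a set) \<Rightarrow> (nat \<Rightarrow> 'a pmf) \<Rightarrow> real \<Rightarrow> real \<Rightarrow> real" where
  "bin_F m A p \<eta> t = measure_pmf.prob (key_unif m A) {x. total_binned m p \<eta> x \<le> t}"

definition bin_F_left :: "nat \<Rightarrow> (nat \<Rightarrow> 'a set) \<Rightarrow> (nat \<Rightarrow> 'a pmf) \<Rightarrow> real \<Rightarrow> real \<Rightarrow> real" where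
  "bin_F_left m A p \<eta> t = measure_pmf.prob (key_unif m A) {x. total_binned m p \<eta> x < t}"

text \<open>
  The summation bounds below are integers (they are cardinalities) written as reals, so the
  index \<open>r\<close> runs over the naturals between them.
\<close>

definition bin_avg :: "nat \<Rightarrow> (nat \<Rightarrow> 'a set) \<Rightarrow> (nat \<Rightarrow> 'a pmf) \<Rightarrow> real \<Rightarrow> real \<Rightarrow> real \<Rightarrow> real" where
  "bin_avg m A p \<eta> \<rho> t =
     (let N = real (card (keys m A)) in
      1 / (N * bin_nu m A p \<eta> t) *
      (\<Sum>r\<in>{r::nat. N * bin_F_left m A p \<eta> t + 1 \<le> real r \<and> real r \<le> N * bin_F m A p \<eta> t}.
         real r powr \<rho>))"

definition binned_f :: "nat \<Rightarrow> (nat \<Rightarrow> 'a set) \<Rightarrow> (nat \<Rightarrow> 'a pmf) \<Rightarrow> real \<Rightarrow> real \<Rightarrow> real" where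
  "binned_f m A p \<eta> \<rho> =
     ln (\<Sum>t\<in>total_binned m p \<eta> ` keys m A. bin_pi m p \<eta> t * bin_avg m A p \<eta> \<rho> t)"

definition binned_s :: "nat \<Rightarrow> (nat \<Rightarrow> 'a set) \<Rightarrow> (nat \<Rightarrow> 'a pmf) \<Rightarrow> real \<Rightarrow> real" where
  "binned_s m A p \<eta> = binned_f m A p \<eta> 1 / binned_f m A p \<eta> (1/2)"


subsection \<open>Saddle quantities\<close>

definition unif_cgf :: "nat \<Rightarrow> (nat \<Rightarrow> 'a set) \<Rightarrow> (nat \<Rightarrow> 'a pmf) \<Rightarrow> real \<Rightarrow> real" where
  "unif_cgf m A p \<tau> =
     ln (measure_pmf.expectation (key_unif m A) (\<lambda>x. exp (\<tau> * total_surprisal m p x)))"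

definition saddle_z :: "nat \<Rightarrow> (nat \<Rightarrow> 'a set) \<Rightarrow> (nat \<Rightarrow> 'a pmf) \<Rightarrow> real \<Rightarrow> real" where
  "saddle_z m A p \<tau> = \<bar>\<tau>\<bar> * sqrt (deriv (deriv (unif_cgf m A p)) \<tau>)"

text \<open>
  The supremum of \<open>z\<^sub>t\<close> to the power \<open>-2\<close> over the saddle range; here \<open>\<tau>\<close> is the solution \<open>\<tau>\<^sub>t\<close> of
  \<open>\<Lambda>\<^sub>U'(\<tau>) = t\<close>.  The constraint \<open>t \<ge> H\<close> amounts to \<open>\<tau> \<ge> -1\<close>.  Only the lower tail \<open>\<tau> \<le> 0\<close>
  belongs to the saddle range: as \<open>\<tau> \<rightarrow> \<infinity>\<close>, i.e. \<open>t \<rightarrow> max S\<close>, one has \<open>z\<^sub>t \<rightarrow> 0\<close>, so the supremum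
  over both tails would always be infinite.  The supremum is one of nonnegative numbers, so it is
  \<open>0\<close> over an empty range (\<open>\<tau>\<^sub>0 > 1\<close>).
\<close>

definition zbar_inv_sq :: "nat \<Rightarrow> (nat \<Rightarrow> 'a set) \<Rightarrow> (nat \<Rightarrow> 'a pmf) \<Rightarrow> real \<Rightarrow> real" where
  "zbar_inv_sq m A p \<tau>\<^sub>0 =
     Sup (insert 0 {1 / (saddle_z m A p \<tau>)\<^sup>2 | t \<tau>.
        deriv (unif_cgf m A p) \<tau> = t \<and> mean_surprisal m p \<le> t \<and> \<tau>\<^sub>0 \<le> \<bar>\<tau>\<bar> \<and> \<tau> \<le> 0})"


subsection \<open>Local-CLT scalars\<close>

definition tilted :: "(nat \<Rightarrow> 'a set) \<Rightarrow> (nat \<Rightarrow> 'a pmf) \<Rightarrow> real \<Rightarrow> nat \<Rightarrow> 'a pmf" where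
  "tilted A p \<tau> i =
     embed_pmf (\<lambda>a. if a \<in> A i
       then exp (\<tau> * surprisal p i a) / (\<Sum>b\<in>A i. exp (\<tau> * surprisal p i b)) else 0)"

lemma pmf_tilted:
  assumes "finite (A i)" "A i \<noteq> {}"
  shows "pmf (tilted A p \<tau> i) a =
    (if a \<in> A i then exp (\<tau> * surprisal p i a) / (\<Sum>b\<in>A i. exp (\<tau> * surprisal p i b)) else 0)"
proof -
  let ?Z = "\<Sum>b\<in>A i. exp (\<tau> * surprisal p i b)"
  let ?w = "\<lambda>a. if a \<in> A i then exp (\<tau> * surprisal p i a) / ?Z else 0"
  have Z: "?Z > 0" using assms by (intro sum_pos) auto
  have nn: "?w a \<ge> 0" for a using Z by auto
  have "(\<integral>\<^sup>+a. ennreal (?w a) \<partial>count_space UNIV) = (\<Sum>a\<in>A i. ennreal (?w a))"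
    by (rule nn_integral_count_space'[OF assms(1)]) auto
  also have "\<dots> = ennreal (\<Sum>a\<in>A i. ?w a)" by (rule sum_ennreal[OF nn])
  also have "(\<Sum>a\<in>A i. ?w a) = 1" using Z by (simp flip: sum_divide_distrib)
  finally have "(\<integral>\<^sup>+a. ennreal (?w a) \<partial>count_space UNIV) = 1" by simp
  from pmf_embed_pmf[of ?w, OF nn this] show ?thesis unfolding tilted_def by simp
qed

definition tilt_mean :: "(nat \<Rightarrow> 'a set) \<Rightarrow> (nat \<Rightarrow> 'a pmf) \<Rightarrow> real \<Rightarrow> real \<Rightarrow> nat \<Rightarrow> real" where
  "tilt_mean A p \<eta> \<tau> i = measure_pmf.expectation (tilted A p \<tau> i) (binned_surprisal p \<eta> i)"

definition tilt_sd :: "(nat \<Rightarrow> 'a set) \<Rightarrow> (nat \<Rightarrow> 'a pmf) \<Rightarrow> real \<Rightarrow> real \<Rightarrow> nat \<Rightarrow> real" where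
  "tilt_sd A p \<eta> \<tau> i = sqrt (measure_pmf.variance (tilted A p \<tau> i) (binned_surprisal p \<eta> i))"

definition total_sd :: "nat \<Rightarrow> (nat \<Rightarrow> 'a set) \<Rightarrow> (nat \<Rightarrow> 'a pmf) \<Rightarrow> real \<Rightarrow> real \<Rightarrow> real" where
  "total_sd m A p \<eta> \<tau> = sqrt (\<Sum>i=1..m. (tilt_sd A p \<eta> \<tau> i)\<^sup>2)"

definition third_moment :: "nat \<Rightarrow> (nat \<Rightarrow> 'a set) \<Rightarrow> (nat \<Rightarrow> 'a pmf) \<Rightarrow> real \<Rightarrow> real \<Rightarrow> real" where
  "third_moment m A p \<eta> \<tau> =
     (\<Sum>i=1..m. measure_pmf.expectation (tilted A p \<tau> i)
        (\<lambda>a. \<bar>binned_surprisal p \<eta> i a - tilt_mean A p \<eta> \<tau> i\<bar> ^ 3))"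

definition tilt_char :: "(nat \<Rightarrow> 'a set) \<Rightarrow> (nat \<Rightarrow> 'a pmf) \<Rightarrow> real \<Rightarrow> real \<Rightarrow> nat \<Rightarrow> real \<Rightarrow> complex" where
  "tilt_char A p \<eta> \<tau> i t =
     measure_pmf.expectation (tilted A p \<tau> i)
       (\<lambda>a. exp (\<i> * complex_of_real (t * (binned_surprisal p \<eta> i a - tilt_mean A p \<eta> \<tau> i))))"

definition lclt_Q :: "nat \<Rightarrow> (nat \<Rightarrow> 'a set) \<Rightarrow> (nat \<Rightarrow> 'a pmf) \<Rightarrow> real \<Rightarrow> real \<Rightarrow> real \<Rightarrow> real" where
  "lclt_Q m A p \<eta> \<tau> t = (\<Sum>i=1..m. (cmod (tilt_char A p \<eta> \<tau> i t - 1))\<^sup>2)"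

text \<open>
  In the degenerate case \<open>\<varsigma>\<^sub>\<tau> = 0\<close>, where the quotients below are not meaningful,
  division by zero gives \<open>\<delta>\<^sub>1 = 0\<close> and hence \<open>\<Lambda>\<^sub>\<eta>(\<tau>) = 0\<close>, so the span condition excludes this case.
\<close>

definition lclt_delta :: "nat \<Rightarrow> (nat \<Rightarrow> 'a set) \<Rightarrow> (nat \<Rightarrow> 'a pmf) \<Rightarrow> real \<Rightarrow> real \<Rightarrow> real" where
  "lclt_delta m A p \<eta> \<tau> =
     min (3 * (total_sd m A p \<eta> \<tau>)\<^sup>2 / (2 * third_moment m A p \<eta> \<tau>))
         (1 / Max (tilt_sd A p \<eta> \<tau> ` {1..m}))"

text \<open>
  The sum over unordered pairs of letters is half the sum over all ordered pairs; the diagonal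
  terms vanish.
\<close>

definition span_sum :: "nat \<Rightarrow> (nat \<Rightarrow> 'a set) \<Rightarrow> (nat \<Rightarrow> 'a pmf) \<Rightarrow> real \<Rightarrow> real \<Rightarrow> real \<Rightarrow> real" where
  "span_sum m A p \<eta> \<tau> t =
     (\<Sum>i=1..m. 1/2 * (\<Sum>a\<in>A i. \<Sum>b\<in>A i.
        4 * pmf (tilted A p \<tau> i) a * pmf (tilted A p \<tau> i) b *
        (sin (t * (binned_surprisal p \<eta> i a - binned_surprisal p \<eta> i b) / 2))\<^sup>2))"

definition span_Lambda :: "nat \<Rightarrow> (nat \<Rightarrow> 'a set) \<Rightarrow> (nat \<Rightarrow> 'a pmf) \<Rightarrow> real \<Rightarrow> real \<Rightarrow> ereal" where
  "span_Lambda m A p \<eta> \<tau> =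
     (if lclt_delta m A p \<eta> \<tau> \<ge> pi / \<eta> then \<infinity>
      else INF t\<in>{t. lclt_delta m A p \<eta> \<tau> \<le> \<bar>t\<bar> \<and> \<bar>t\<bar> \<le> pi / \<eta>}. ereal (span_sum m A p \<eta> \<tau> t))"

definition lclt_q :: "nat \<Rightarrow> (nat \<Rightarrow> 'a set) \<Rightarrow> (nat \<Rightarrow> 'a pmf) \<Rightarrow> real \<Rightarrow> real \<Rightarrow> real" where
  "lclt_q m A p \<eta> \<tau> =
     (let \<delta> = lclt_delta m A p \<eta> \<tau>; \<sigma> = total_sd m A p \<eta> \<tau>;
          \<beta> = third_moment m A p \<eta> \<tau>; Q = lclt_Q m A p \<eta> \<tau> in
      \<sigma> / (2 * pi) *
      integral {-\<delta>..\<delta>} (\<lambda>t. (\<beta> * \<bar>t\<bar> ^ 3 / 6 * (exp (Q t) - 1) + Q t * exp (Q t)) *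
                            exp (- (\<sigma>\<^sup>2 * t\<^sup>2 / 4))))"

definition normal_tail :: "real \<Rightarrow> real" where
  "normal_tail x = measure std_normal_distribution {x<..}"

text \<open>The exponential \<open>exp (- L / 2)\<close> for \<open>L\<close> in \<open>[0, \<infinity>]\<close>.\<close>

definition exp_neg_half :: "ereal \<Rightarrow> real" where
  "exp_neg_half L = (if L = \<infinity> then 0 else exp (- real_of_ereal L / 2))"

definition lclt_eps :: "nat \<Rightarrow> (nat \<Rightarrow> 'a set) \<Rightarrow> (nat \<Rightarrow> 'a pmf) \<Rightarrow> real \<Rightarrow> real \<Rightarrow> real" where
  "lclt_eps m A p \<eta> \<tau> =
     4 / (3 * pi) * (third_moment m A p \<eta> \<tau> / (total_sd m A p \<eta> \<tau>) ^ 3)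
     + lclt_q m A p \<eta> \<tau>
     + total_sd m A p \<eta> \<tau> / \<eta> * exp_neg_half (span_Lambda m A p \<eta> \<tau>)
     + sqrt (2 / pi) * normal_tail (total_sd m A p \<eta> \<tau> * lclt_delta m A p \<eta> \<tau>)"

definition lclt_eps_sup :: "nat \<Rightarrow> (nat \<Rightarrow> 'a set) \<Rightarrow> (nat \<Rightarrow> 'a pmf) \<Rightarrow> real \<Rightarrow> real" where
  "lclt_eps_sup m A p \<eta> = (SUP \<tau>\<in>{-1..0}. lclt_eps m A p \<eta> \<tau>)"

definition surprisal_spread :: "(nat \<Rightarrow> 'a set) \<Rightarrow> (nat \<Rightarrow> 'a pmf) \<Rightarrow> nat \<Rightarrow> real" where
  "surprisal_spread A p i = Max (surprisal p i ` A i) - Min (surprisal p i ` A i)"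

end

theory Submission
  imports Defs
begin

text \<open>
  Write \<open>w = exp (- S)\<close> and \<open>w' = exp (- S') = w exp (- D)\<close>, where \<open>S'\<close> is the binned surprisal
  and \<open>D\<close> is a sum of coordinate errors in \<open>[0, \<eta>]\<close>.  An order that sorts by \<open>S\<close> minimises the
  \<open>w\<close>-weighted guessing moments, and one that sorts by \<open>S'\<close> minimises the \<open>w'\<close>-weighted ones.
  Passing from \<open>w\<close> to \<open>w'\<close> and back therefore costs only factors \<open>exp (\<plusminus>D)\<close>, averaged over the
  weights \<open>w G powr \<rho>\<close>.  By Arikan's bounds these weights are dominated, up to the factor
  \<open>(1 + ln N) powr \<rho> = exp (o m)\<close>, by a product law; Hoelder's inequality with exponent \<open>1 / \<eta>\<close> makes this
  factor harmless, and under the product law \<open>D / \<eta>\<close> has independent terms in \<open>[0, 1]\<close>, so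
  Kantorovich's inequality bounds \<open>E[exp (D / \<eta>)] E[exp (- D / \<eta>)]\<close> by \<open>1.3 ^ m\<close>.  Hence
  \<open>0 \<le> f\<^sub>\<eta> - f \<le> (0.3 + o 1) m \<eta>\<close> at both exponents.  This beats the constant in the theorem, so
  \<open>\<epsilon>\<^sub>m = 0\<close> is admissible for large \<open>m\<close>.
\<close>

subsection \<open>Guessing orders on a finite set\<close>

text \<open>Dividing \<open>a\<close> and \<open>b\<close> by their sums reduces this to Young's
  inequality, applied term by term.\<close>

lemma Holder_sum_powr:
  fixes a b :: "'b \<Rightarrow> real"
  assumes "finite K" "K \<noteq> {}" and pos: "\<And>x. x \<in> K \<Longrightarrow> a x > 0" "\<And>x. x \<in> K \<Longrightarrow> b x > 0"
    and "0 \<le> \<theta>" "\<theta> \<le> 1"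
  shows "(\<Sum>x\<in>K. a x powr \<theta> * b x powr (1 - \<theta>)) \<le> (\<Sum>x\<in>K. a x) powr \<theta> * (\<Sum>x\<in>K. b x) powr (1 - \<theta>)"
proof -
  define U V where "U = sum a K" and "V = sum b K"
  have UV: "U > 0" "V > 0" unfolding U_def V_def using assms by (auto intro: sum_pos)
  have "(\<Sum>x\<in>K. a x powr \<theta> * b x powr (1 - \<theta>))
      \<le> (\<Sum>x\<in>K. (U powr \<theta> * V powr (1 - \<theta>)) * (\<theta> * (a x / U) + (1 - \<theta>) * (b x / V)))"
  proof (rule sum_mono)
    fix x assume x: "x \<in> K"
    have "a x powr \<theta> * b x powr (1 - \<theta>)
        = (U powr \<theta> * V powr (1 - \<theta>)) * ((a x / U) powr \<theta> * (b x / V) powr (1 - \<theta>))"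
      using pos[OF x] UV by (simp add: powr_divide)
    also have "\<dots> \<le> (U powr \<theta> * V powr (1 - \<theta>)) * (\<theta> * (a x / U) + (1 - \<theta>) * (b x / V))"
      using pos[OF x] UV assms by (intro mult_left_mono Youngs_inequality_0) auto
    finally show "a x powr \<theta> * b x powr (1 - \<theta>) \<le> \<dots>" .
  qed
  also have "\<dots> = (U powr \<theta> * V powr (1 - \<theta>)) * (\<theta> * (U / U) + (1 - \<theta>) * (V / V))"
    unfolding sum_distrib_left[symmetric] sum.distrib sum_divide_distrib[symmetric] U_def V_def ..
  also have "\<dots> = U powr \<theta> * V powr (1 - \<theta>)" using UV by simp
  finally show ?thesis unfolding U_def V_def .
qed

text \<open>\<open>guess_order\<close> for an arbitrary finite set and score, so that sorting by the
  exact and by the binned surprisal can be treated alike.\<close>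

definition guessing_order :: "'b set \<Rightarrow> ('b \<Rightarrow> real) \<Rightarrow> ('b \<Rightarrow> nat) \<Rightarrow> bool" where
  "guessing_order K S G \<longleftrightarrow>
     bij_betw G K {1..card K} \<and> (\<forall>x\<in>K. \<forall>y\<in>K. G x \<le> G y \<longrightarrow> S x \<le> S y)"

lemma card_rank_le:
  assumes "bij_betw G K {1..card K}"
  shows "card {x\<in>K. G x \<le> k} = min k (card K)"
proof -
  have "bij_betw G {x\<in>K. G x \<le> k} {1..min k (card K)}"
    using assms unfolding bij_betw_def inj_on_def by (auto simp: image_iff) (metis atLeastAtMost_iff image_iff)
  then show ?thesis by (simp add: bij_betw_same_card)
qed

text \<open>Exchange argument: \<open>T - T'\<close> and \<open>T' - T\<close> have equally many
  elements, and a threshold \<open>\<theta>\<close> separates their weights.\<close>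

lemma sum_top_le:
  fixes w :: "'b \<Rightarrow> real"
  assumes fin: "finite K" and sub: "T \<subseteq> K" "T' \<subseteq> K" and card: "card T = card T'"
    and top: "\<And>x y. x \<in> T \<Longrightarrow> y \<in> K - T \<Longrightarrow> w y \<le> w x"
  shows "sum w T' \<le> sum w T"
proof (cases "T = {}")
  case True
  then show ?thesis using fin sub card by (metis card_0_eq card.empty finite_subset order_refl)
next
  case False
  have f: "finite T" "finite T'" using fin sub finite_subset by auto
  define \<theta> where "\<theta> = Min (w ` T)"
  have le: "\<theta> \<le> w x" if "x \<in> T" for x using that f by (auto simp: \<theta>_def)
  have "\<theta> \<in> w ` T" unfolding \<theta>_def using f False by (intro Min_in) auto
  then have ge: "w y \<le> \<theta>" if "y \<in> K - T" for y using top that by auto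
  have c: "card (T - T') = card (T' - T)"
    using card f by (simp add: card_le_sym_Diff order_antisym)
  have "sum w T' = sum w (T' \<inter> T) + sum w (T' - T)" using f sum.Int_Diff by blast
  also have "sum w (T' - T) \<le> of_nat (card (T' - T)) * \<theta>"
    using ge sub by (intro sum_bounded_above) auto
  also have "\<dots> \<le> sum w (T - T')" unfolding c[symmetric] using le by (intro sum_bounded_below) auto
  also have "sum w (T' \<inter> T) + sum w (T - T') = sum w T"
    using f sum.Int_Diff[of T w T'] by (simp add: Int_commute)
  finally show ?thesis by simp
qed

text \<open>Summation by parts. The cost then depends on the order \<open>G\<close> only through the
  weights of its initial segments, which \<open>sum_top_le\<close> can compare.\<close>

lemma sum_rank_Abel:
  fixes w :: "'b \<Rightarrow> real" and c :: "nat \<Rightarrow> real"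
  assumes "finite K" "\<And>x. x \<in> K \<Longrightarrow> G x \<le> N"
  shows "(\<Sum>x\<in>K. w x * c (G x)) = c N * sum w K - (\<Sum>k<N. (c (Suc k) - c k) * sum w {x\<in>K. G x \<le> k})"
proof -
  have c: "c r = c N - (\<Sum>k<N. if r \<le> k then c (Suc k) - c k else 0)" if "r \<le> N" for r
  proof -
    have "(\<Sum>k<N. if r \<le> k then c (Suc k) - c k else 0) = (\<Sum>k\<in>{r..<N}. c (Suc k) - c k)"
      by (rule sum.mono_neutral_cong_right) auto
    also have "\<dots> = c N - c r" using that by (rule sum_Suc_diff')
    finally show ?thesis by simp
  qed
  have "(\<Sum>x\<in>K. w x * c (G x))
      = (\<Sum>x\<in>K. w x * c N - (\<Sum>k<N. (c (Suc k) - c k) * (if G x \<le> k then w x else 0)))"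
  proof (rule sum.cong[OF refl])
    fix x assume "x \<in> K"
    then show "w x * c (G x) = w x * c N - (\<Sum>k<N. (c (Suc k) - c k) * (if G x \<le> k then w x else 0))"
      using c[OF assms(2)] by (simp add: right_diff_distrib sum_distrib_left if_distrib mult.commute cong: if_cong)
  qed
  also have "\<dots> = c N * sum w K - (\<Sum>k<N. (c (Suc k) - c k) * (\<Sum>x\<in>K. if G x \<le> k then w x else 0))"
    by (simp add: sum_subtractf sum_distrib_left mult.commute sum.swap[of _ K])
  also have "(\<lambda>k. \<Sum>x\<in>K. if G x \<le> k then w x else 0) = (\<lambda>k. sum w {x\<in>K. G x \<le> k})"
    using assms(1) by (intro ext) (simp add: sum.inter_filter)
  finally show ?thesis .
qed

text \<open>Each initial segment of \<open>G\<close> collects the largest possible weight, and the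
  increments of \<open>c\<close>, which multiply these weights with a minus sign, are
  nonnegative.\<close>

lemma guessing_order_optimal:
  fixes c :: "nat \<Rightarrow> real"
  assumes fin: "finite K" and G: "guessing_order K S G" and G': "bij_betw G' K {1..card K}"
    and "mono c"
  shows "(\<Sum>x\<in>K. exp (- S x) * c (G x)) \<le> (\<Sum>x\<in>K. exp (- S x) * c (G' x))"
proof -
  let ?w = "\<lambda>x. exp (- S x)"
  have bij: "bij_betw G K {1..card K}" using G by (simp add: guessing_order_def)
  have le: "G x \<le> card K" "G' x \<le> card K" if "x \<in> K" for x
    using bij_betwE[OF bij] bij_betwE[OF G'] that by auto
  have "sum ?w {x\<in>K. G' x \<le> k} \<le> sum ?w {x\<in>K. G x \<le> k}" for k
  proof (rule sum_top_le[OF fin])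
    show "card {x\<in>K. G x \<le> k} = card {x\<in>K. G' x \<le> k}"
      using card_rank_le[OF bij] card_rank_le[OF G'] by simp
  next
    fix x y assume "x \<in> {x\<in>K. G x \<le> k}" "y \<in> K - {x\<in>K. G x \<le> k}"
    then show "?w y \<le> ?w x" using G by (auto simp: guessing_order_def)
  qed auto
  then have "(\<Sum>k<card K. (c (Suc k) - c k) * sum ?w {x\<in>K. G' x \<le> k})
      \<le> (\<Sum>k<card K. (c (Suc k) - c k) * sum ?w {x\<in>K. G x \<le> k})"
    using \<open>mono c\<close> by (intro sum_mono mult_left_mono) (auto simp: mono_iff_le_Suc)
  then show ?thesis
    using sum_rank_Abel[OF fin, of G "card K" ?w c] sum_rank_Abel[OF fin, of G' "card K" ?w c] le by simp
qed

lemma guessing_order_le_card: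
  assumes "finite K" "guessing_order K S G" "x \<in> K"
  shows "G x \<le> card {y\<in>K. S y \<le> S x}"
proof -
  have "G x \<le> card K"
    using assms(2,3) by (auto simp: guessing_order_def dest: bij_betwE)
  then have "G x = card {y\<in>K. G y \<le> G x}"
    using card_rank_le[of G K] assms(2) by (simp add: guessing_order_def)
  also have "\<dots> \<le> card {y\<in>K. S y \<le> S x}"
    using assms by (intro card_mono) (auto simp: guessing_order_def)
  finally show ?thesis .
qed

text \<open>Chernoff bound: the indicator of \<open>S y \<le> t\<close> is at most
  \<open>exp (\<alpha> * (t - S y))\<close>.\<close>

lemma card_sublevel_le:
  assumes "finite K" "\<alpha> \<ge> 0"
  shows "real (card {y\<in>K. S y \<le> t}) \<le> exp (\<alpha> * t) * (\<Sum>y\<in>K. exp (- \<alpha> * S y))"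
proof -
  have "real (card {y\<in>K. S y \<le> t}) = (\<Sum>y\<in>K. if S y \<le> t then 1 else 0)"
    using assms by (simp add: sum.inter_filter flip: sum.inter_filter)
  also have "\<dots> \<le> (\<Sum>y\<in>K. exp (\<alpha> * t) * exp (- \<alpha> * S y))"
    using assms by (intro sum_mono) (auto simp flip: exp_add intro!: mult_left_mono)
  finally show ?thesis by (simp add: sum_distrib_left)
qed

lemma harm_le_one_plus_ln:
  assumes "n \<ge> 1" shows "harm n \<le> 1 + ln (real n)"
proof -
  obtain k where k: "n = Suc k" using assms by (cases n) auto
  show ?thesis using decseqD[OF decseq_harm_diff_ln, of 0 k] by (simp add: k harm_def)
qed

text \<open>Arikan's lower bound: Hoelder's inequality with exponent \<open>1 / (1 + \<rho>)\<close>
  separates the moment from a harmonic sum, and the latter gives the logarithmic factor.\<close>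

lemma guessing_moment_lower:
  assumes fin: "finite K" "K \<noteq> {}" and bij: "bij_betw G K {1..card K}" and "\<rho> > 0"
  shows "(\<Sum>x\<in>K. exp (- (1 / (1 + \<rho>)) * S x)) powr (1 + \<rho>)
    \<le> (1 + ln (real (card K))) powr \<rho> * (\<Sum>x\<in>K. exp (- S x) * real (G x) powr \<rho>)"
proof -
  define \<theta> where "\<theta> = 1 / (1 + \<rho>)"
  have \<theta>: "0 \<le> \<theta>" "\<theta> \<le> 1" "\<theta> * (1 + \<rho>) = 1" "(1 - \<theta>) * (1 + \<rho>) = \<rho>" "\<rho> * \<theta> = 1 - \<theta>"
    using \<open>\<rho> > 0\<close> by (auto simp: \<theta>_def field_simps)
  have G1: "G x \<ge> 1" if "x \<in> K" for x using bij_betwE[OF bij] that by auto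
  define M where "M = (\<Sum>x\<in>K. exp (- S x) * real (G x) powr \<rho>)"
  \<comment> \<open>\<open>G\<close> takes every rank exactly once, so the second Hoelder factor is
    a harmonic number.\<close>
  have harm: "(\<Sum>x\<in>K. inverse (real (G x))) = harm (card K)"
    unfolding harm_def using sum.reindex_bij_betw[OF bij, of "\<lambda>r. inverse (real r)"] by simp
  have cK: "card K \<ge> 1" using fin by (simp add: Suc_leI card_gt_0_iff)
  have l: "1 + ln (real (card K)) \<ge> 0" using cK by simp
  \<comment> \<open>The inserted powers of \<open>G x\<close> cancel because
    \<open>\<rho> * \<theta> = 1 - \<theta>\<close>.\<close>
  have "(\<Sum>x\<in>K. exp (- \<theta> * S x))
     = (\<Sum>x\<in>K. (exp (- S x) * real (G x) powr \<rho>) powr \<theta> * inverse (real (G x)) powr (1 - \<theta>))"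
  proof (rule sum.cong[OF refl])
    fix x assume x: "x \<in> K"
    have "(exp (- S x) * real (G x) powr \<rho>) powr \<theta> * inverse (real (G x)) powr (1 - \<theta>)
       = exp (- S x) powr \<theta> * (real (G x) powr (1 - \<theta>) * inverse (real (G x)) powr (1 - \<theta>))"
      using G1[OF x] by (simp add: powr_mult powr_powr \<theta>)
    also have "real (G x) powr (1 - \<theta>) * inverse (real (G x)) powr (1 - \<theta>) = 1"
      using G1[OF x] by (simp flip: powr_mult)
    also have "exp (- S x) powr \<theta> * 1 = exp (- \<theta> * S x)" by (simp add: powr_def mult.commute)
    finally show "exp (- \<theta> * S x) = (exp (- S x) * real (G x) powr \<rho>) powr \<theta> * inverse (real (G x)) powr (1 - \<theta>)" ..
  qed
  also have "\<dots> \<le> M powr \<theta> * (\<Sum>x\<in>K. inverse (real (G x))) powr (1 - \<theta>)"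
    unfolding M_def using fin \<theta> G1 by (intro Holder_sum_powr) (auto simp: less_eq_Suc_le)
  also have "\<dots> \<le> M powr \<theta> * (1 + ln (real (card K))) powr (1 - \<theta>)"
    unfolding harm using harm_le_one_plus_ln[OF cK] \<theta> harm_nonneg
    by (intro mult_left_mono powr_mono2) (auto)
  finally have "(\<Sum>x\<in>K. exp (- \<theta> * S x)) powr (1 + \<rho>) \<le> (M powr \<theta> * (1 + ln (real (card K))) powr (1 - \<theta>)) powr (1 + \<rho>)"
    using \<open>\<rho> > 0\<close> by (intro powr_mono2) (auto intro: sum_nonneg)
  also have "\<dots> = M * (1 + ln (real (card K))) powr \<rho>"
    using l by (simp add: powr_mult powr_powr \<theta> M_def sum_nonneg)
  finally show ?thesis unfolding M_def \<theta>_def by (simp add: mult.commute)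
qed

text \<open>Hoelder's inequality turns \<open>E\<close> into \<open>E / h\<close> under an outer
  power \<open>h\<close>. A large domination constant \<open>L\<close> then enters only as
  \<open>L powr h\<close>, which is what makes a crude comparison with a product weight
  affordable.\<close>

lemma tilted_sum_le:
  fixes W \<mu> E :: "'b \<Rightarrow> real"
  assumes fin: "finite K" "K \<noteq> {}" and W: "\<And>x. x \<in> K \<Longrightarrow> W x > 0"
    and le: "\<And>x. x \<in> K \<Longrightarrow> W x \<le> L * \<mu> x * sum W K" and h: "0 < h" "h \<le> 1"
  shows "(\<Sum>x\<in>K. W x * exp (E x)) \<le> sum W K * (L * (\<Sum>x\<in>K. \<mu> x * exp (E x / h))) powr h"
proof -
  have pos: "sum W K > 0" using fin W by (intro sum_pos) auto
  have "(\<Sum>x\<in>K. W x * exp (E x)) = (\<Sum>x\<in>K. (W x * exp (E x / h)) powr h * W x powr (1 - h))"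
  proof (rule sum.cong[OF refl])
    fix x assume x: "x \<in> K"
    have "(W x * exp (E x / h)) powr h = W x powr h * exp (E x)"
      using W[OF x] h by (subst powr_mult) (auto simp: powr_def)
    then show "W x * exp (E x) = (W x * exp (E x / h)) powr h * W x powr (1 - h)"
      using W[OF x] powr_add[of "W x" h "1 - h"] by simp
  qed
  also have "\<dots> \<le> (\<Sum>x\<in>K. W x * exp (E x / h)) powr h * sum W K powr (1 - h)"
    using fin W h by (intro Holder_sum_powr) auto
  also have "\<dots> \<le> (\<Sum>x\<in>K. L * \<mu> x * sum W K * exp (E x / h)) powr h * sum W K powr (1 - h)"
    using h less_imp_le[OF W] by (intro mult_right_mono[OF powr_mono2] sum_mono sum_nonneg mult_right_mono[OF le]) (auto simp: less_imp_le)
  also have "(\<Sum>x\<in>K. L * \<mu> x * sum W K * exp (E x / h)) = (L * (\<Sum>x\<in>K. \<mu> x * exp (E x / h))) * sum W K"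
    by (simp add: sum_distrib_left sum_distrib_right ac_simps)
  also have "((L * (\<Sum>x\<in>K. \<mu> x * exp (E x / h))) * sum W K) powr h * sum W K powr (1 - h)
      = (L * (\<Sum>x\<in>K. \<mu> x * exp (E x / h))) powr h * (sum W K powr h * sum W K powr (1 - h))"
    by (simp add: powr_mult)
  also have "sum W K powr h * sum W K powr (1 - h) = sum W K" using pos by (simp flip: powr_add)
  finally show ?thesis by (simp add: mult.commute)
qed

text \<open>
  The crude bound \<open>B x \<le> #{y. S y \<le> S x} powr \<rho>\<close> dominates the weight \<open>exp (- S) B\<close> by the
  product weight \<open>exp (- S / (1 + \<rho>))\<close>, and the lower bound on the total loses only
  \<open>(1 + ln N) powr \<rho>\<close>, which the exponent \<open>h\<close> then makes negligible.
\<close>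

lemma guessing_weight_tilt:
  assumes fin: "finite K" "K \<noteq> {}" and "\<rho> > 0" and \<alpha>: "\<alpha> = 1 / (1 + \<rho>)"
    and B: "\<And>x. x \<in> K \<Longrightarrow> B x > 0" "\<And>x. x \<in> K \<Longrightarrow> B x \<le> real (card {y\<in>K. S y \<le> S x}) powr \<rho>"
    and low: "(\<Sum>x\<in>K. exp (- \<alpha> * S x)) powr (1 + \<rho>)
      \<le> (1 + ln (real (card K))) powr \<rho> * (\<Sum>x\<in>K. exp (- S x) * B x)"
    and h: "0 < h" "h \<le> 1"
  shows "(\<Sum>x\<in>K. exp (- S x) * B x * exp (E x)) \<le> (\<Sum>x\<in>K. exp (- S x) * B x) *
    ((1 + ln (real (card K))) powr \<rho> *
     ((\<Sum>x\<in>K. exp (- \<alpha> * S x) * exp (E x / h)) / (\<Sum>x\<in>K. exp (- \<alpha> * S x)))) powr h"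
proof -
  define Z where "Z = (\<Sum>x\<in>K. exp (- \<alpha> * S x))"
  have Z: "Z > 0" unfolding Z_def using fin by (intro sum_pos) auto
  \<comment> \<open>The second identity is the reason for this \<open>\<alpha>\<close>: multiplying
    \<open>exp (- S)\<close> by the Chernoff factor \<open>exp (\<rho> * \<alpha> * S)\<close>
    returns \<open>exp (- \<alpha> * S)\<close>, the very weight that \<open>Z\<close>
    normalises.\<close>
  have \<alpha>': "\<alpha> \<ge> 0" "1 - \<rho> * \<alpha> = \<alpha>" using \<open>\<rho> > 0\<close> by (auto simp: \<alpha> field_simps)
  have "(\<Sum>x\<in>K. exp (- S x) * B x * exp (E x)) \<le> (\<Sum>x\<in>K. exp (- S x) * B x) *
    ((1 + ln (real (card K))) powr \<rho> * (\<Sum>x\<in>K. exp (- \<alpha> * S x) / Z * exp (E x / h))) powr h"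
  proof (rule tilted_sum_le[OF fin _ _ h])
    fix x assume x: "x \<in> K"
    have "B x \<le> (exp (\<alpha> * S x) * Z) powr \<rho>"
      using B(2)[OF x] card_sublevel_le[OF fin(1) \<alpha>'(1), of S "S x"] \<open>\<rho> > 0\<close> unfolding Z_def
      by (meson order_trans powr_mono2 of_nat_0_le_iff less_imp_le)
    also have "\<dots> = exp (\<rho> * \<alpha> * S x) * Z powr \<rho>"
      using Z by (subst powr_mult) (auto simp: powr_def)
    finally have "exp (- S x) * B x \<le> exp (- S x) * (exp (\<rho> * \<alpha> * S x) * Z powr \<rho>)"
      by simp
    also have "\<dots> = exp (- \<alpha> * S x) * Z powr \<rho>"
    proof -
      have "- S x + \<rho> * \<alpha> * S x = - \<alpha> * S x" using arg_cong[OF \<alpha>'(2), of "\<lambda>c. c * S x"] by (simp add: algebra_simps)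
      then show ?thesis by (simp flip: mult_exp_exp add: mult.assoc[symmetric] exp_add[symmetric])
    qed
    also have "\<dots> = exp (- \<alpha> * S x) / Z * Z powr (1 + \<rho>)"
      using Z by (simp add: powr_add)
    also have "\<dots> \<le> exp (- \<alpha> * S x) / Z * ((1 + ln (real (card K))) powr \<rho> * (\<Sum>x\<in>K. exp (- S x) * B x))"
      using low Z unfolding Z_def by (intro mult_left_mono) auto
    finally show "exp (- S x) * B x
      \<le> (1 + ln (real (card K))) powr \<rho> * (exp (- \<alpha> * S x) / Z) * (\<Sum>x\<in>K. exp (- S x) * B x)"
      by (simp add: ac_simps)
  qed (use B in auto)
  then show ?thesis unfolding Z_def[symmetric] by (simp add: sum_divide_distrib)
qed

section \<open>Averages over ties: conditional expectations given \<open>T\<close> under the uniform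
  law on \<open>K\<close>\<close>

definition tie_average :: "'b set \<Rightarrow> ('b \<Rightarrow> real) \<Rightarrow> ('b \<Rightarrow> real) \<Rightarrow> 'b \<Rightarrow> real" where
  "tie_average K T f x = (\<Sum>y\<in>{y\<in>K. T y = T x}. f y) / real (card {y\<in>K. T y = T x})"

text \<open>Weights that depend on \<open>T\<close> alone do not notice the averaging; interchanging
  the double sum over tied pairs shows it.\<close>

lemma sum_tie_average:
  assumes fin: "finite K"
  shows "(\<Sum>x\<in>K. w (T x) * tie_average K T f x) = (\<Sum>x\<in>K. w (T x) * f x)"
proof -
  let ?n = "\<lambda>x. real (card {y\<in>K. T y = T x})"
  have n: "?n x > 0" if "x \<in> K" for x using that fin by (auto simp: card_gt_0_iff)
  have "(\<Sum>x\<in>K. w (T x) * tie_average K T f x)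
      = (\<Sum>x\<in>K. \<Sum>y\<in>K. if T y = T x then w (T x) * f y / ?n x else 0)"
    using fin by (intro sum.cong refl)
      (simp add: tie_average_def sum_distrib_left sum_divide_distrib flip: sum.inter_filter)
  also have "\<dots> = (\<Sum>y\<in>K. \<Sum>x\<in>K. if T x = T y then w (T y) * f y / ?n y else 0)"
    by (subst sum.swap) (intro sum.cong refl, auto)
  also have "\<dots> = (\<Sum>y\<in>K. w (T y) * f y)"
  proof (rule sum.cong[OF refl])
    fix y assume y: "y \<in> K"
    show "(\<Sum>x\<in>K. if T x = T y then w (T y) * f y / ?n y else 0) = w (T y) * f y"
    proof -
      have "(\<Sum>x\<in>K. if T x = T y then w (T y) * f y / ?n y else 0)
          = (\<Sum>x\<in>{x\<in>K. T x = T y}. w (T y) * f y / ?n y)"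
        using fin by (rule sum.inter_filter[symmetric])
      also have "\<dots> = ?n y * (w (T y) * f y / ?n y)" by simp
      also have "\<dots> = w (T y) * f y" using n[OF y] by (simp del: of_nat_eq_0_iff of_nat_0_less_iff)
      finally show ?thesis .
    qed
  qed
  finally show ?thesis .
qed

text \<open>Chebyshev's sum inequality on each tie class: if weights and values are oppositely
  ordered, replacing the values by their mean can only increase the weighted sum.\<close>

lemma sum_le_tie_average:
  assumes fin: "finite K"
    and anti: "\<And>x y. x \<in> K \<Longrightarrow> y \<in> K \<Longrightarrow> T x = T y \<Longrightarrow> (w x - w y) * (f x - f y) \<le> 0"
  shows "(\<Sum>x\<in>K. w x * f x) \<le> (\<Sum>x\<in>K. w x * tie_average K T f x)"
proof -
  let ?n = "\<lambda>x. real (card {y\<in>K. T y = T x})"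
  have n: "?n x > 0" if "x \<in> K" for x using that fin by (auto simp: card_gt_0_iff)
  define d where "d x y = (if T y = T x then w x * (f y - f x) / ?n x else 0)" for x y
  have "w x * tie_average K T f x - w x * f x = (\<Sum>y\<in>K. d x y)" if "x \<in> K" for x
  proof -
    have "(\<Sum>y\<in>K. d x y) = (\<Sum>y\<in>{y\<in>K. T y = T x}. w x * (f y - f x) / ?n x)"
      using fin by (simp add: d_def sum.inter_filter)
    also have "\<dots> = w x * ((\<Sum>y\<in>{y\<in>K. T y = T x}. f y) - ?n x * f x) / ?n x"
      by (simp add: sum_divide_distrib[symmetric] sum_distrib_left[symmetric] sum_subtractf)
    also have "\<dots> = w x * tie_average K T f x - w x * f x"
      using n[OF that] unfolding tie_average_def by (simp add: field_simps)
    finally show ?thesis ..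
  qed
  then have "(\<Sum>x\<in>K. w x * tie_average K T f x) - (\<Sum>x\<in>K. w x * f x) = (\<Sum>x\<in>K. \<Sum>y\<in>K. d x y)"
    by (simp flip: sum_subtractf)
  \<comment> \<open>Symmetrising in \<open>x\<close> and \<open>y\<close> turns each tied pair into
    \<open>- (w x - w y) * (f x - f y)\<close> over the common class size.\<close>
  moreover have "0 \<le> 2 * (\<Sum>x\<in>K. \<Sum>y\<in>K. d x y)"
  proof -
    have "2 * (\<Sum>x\<in>K. \<Sum>y\<in>K. d x y) = (\<Sum>x\<in>K. \<Sum>y\<in>K. d x y) + (\<Sum>x\<in>K. \<Sum>y\<in>K. d y x)"
      by (subst (3) sum.swap) simp
    also have "\<dots> = (\<Sum>x\<in>K. \<Sum>y\<in>K. d x y + d y x)" by (simp add: sum.distrib)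
    also have "\<dots> \<ge> 0"
    proof (intro sum_nonneg)
      fix x y assume xy: "x \<in> K" "y \<in> K"
      show "0 \<le> d x y + d y x"
      proof (cases "T x = T y")
        case True
        then have "d x y + d y x = - ((w x - w y) * (f x - f y)) / ?n x"
          by (simp add: d_def field_simps flip: add_divide_distrib)
        then show ?thesis using anti[OF xy True] n[OF xy(1)] by (simp add: divide_nonpos_pos)
      qed (simp add: d_def)
    qed
    finally show ?thesis .
  qed
  ultimately show ?thesis by simp
qed

section \<open>Orders sorted by a score with ties\<close>

lemma guessing_order_refine:
  fixes T :: "'b \<Rightarrow> real" and G :: "'b \<Rightarrow> nat"
  assumes fin: "finite K" and inj: "inj_on G K"
  shows "\<exists>H. guessing_order K T H \<and> (\<forall>x\<in>K. \<forall>y\<in>K. T x = T y \<longrightarrow> H x \<le> H y \<longrightarrow> G x \<le> G y)"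
proof -
  define R where "R y x \<longleftrightarrow> T y < T x \<or> T y = T x \<and> G y \<le> G x" for x y
  \<comment> \<open>\<open>H\<close> ranks lexicographically by \<open>T\<close>, then
    \<open>G\<close>. A key counts among its own predecessors, so ranks start at 1.\<close>
  define H where "H x = card {y\<in>K. R y x}" for x
  have less: "H x < H y" if "x \<in> K" "y \<in> K" "\<not> R y x" for x y
    unfolding H_def using that fin by (intro psubset_card_mono) (auto simp: R_def)
  have le: "R x y" if "x \<in> K" "y \<in> K" "H x \<le> H y" for x y
    using less[of y x] that by (meson linorder_not_le)
  have "inj_on H K"
  proof (rule inj_onI)
    fix x y assume "x \<in> K" "y \<in> K" "H x = H y"
    with le[of x y] le[of y x] have "G x = G y" by (auto simp: R_def)
    then show "x = y" using inj \<open>x \<in> K\<close> \<open>y \<in> K\<close> by (auto dest: inj_onD)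
  qed
  moreover have "H ` K = {1..card K}"
  proof (rule card_subset_eq)
    show "H ` K \<subseteq> {1..card K}"
    proof safe
      fix x assume x: "x \<in> K"
      have "x \<in> {y\<in>K. R y x}" using x by (simp add: R_def)
      then have "H x > 0" unfolding H_def using fin by (auto simp: card_gt_0_iff)
      moreover have "H x \<le> card K" unfolding H_def using fin by (auto intro: card_mono)
      ultimately show "H x \<in> {1..card K}" by simp
    qed
    show "card (H ` K) = card {1..card K}" using \<open>inj_on H K\<close> by (simp add: card_image)
  qed simp
  ultimately show ?thesis
    using le unfolding guessing_order_def bij_betw_def R_def
    by (intro exI[of _ H]) (metis order_le_less order_less_irrefl)
qed

text \<open>This block of ranks is the range of summation in \<open>bin_avg\<close>. One inclusion
  suffices, since both sides have as many elements as the level set.\<close>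

lemma guessing_order_image_level:
  fixes K :: "'b set"
  assumes fin: "finite K" and G: "guessing_order K T G"
  shows "G ` {x\<in>K. T x = t} = {card {x\<in>K. T x < t} + 1..card {x\<in>K. T x \<le> t}}"
proof (rule card_subset_eq)
  have bij: "bij_betw G K {1..card K}" and mon: "\<And>x y. x \<in> K \<Longrightarrow> y \<in> K \<Longrightarrow> G x \<le> G y \<Longrightarrow> T x \<le> T y"
    using G by (auto simp: guessing_order_def)
  have inj: "inj_on G {x\<in>K. T x = t}" using bij by (auto simp: bij_betw_def inj_on_def)
  show "G ` {x\<in>K. T x = t} \<subseteq> {card {x\<in>K. T x < t} + 1..card {x\<in>K. T x \<le> t}}"
  proof safe
    fix x assume x: "x \<in> K" "t = T x"
    have c: "card {y\<in>K. G y \<le> G x} = G x"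
      using card_rank_le[OF bij, of "G x"] bij_betwE[OF bij] x by auto
    have "G y \<le> G x" if "y \<in> K" "T y < T x" for y
      using mon[of x y] that x by force
    \<comment> \<open>Strict, because \<open>x\<close> itself is counted only on the right; this
      accounts for the \<open>+ 1\<close> at the lower end.\<close>
    then have "card {y\<in>K. T y < T x} < card {y\<in>K. G y \<le> G x}"
      using fin x by (intro psubset_card_mono) auto
    moreover have "card {y\<in>K. G y \<le> G x} \<le> card {y\<in>K. T y \<le> T x}"
      using fin mon x by (intro card_mono) auto
    ultimately show "G x \<in> {card {y\<in>K. T y < T x} + 1..card {y\<in>K. T y \<le> T x}}" using c by simp
  qed
  have "{x\<in>K. T x \<le> t} = {x\<in>K. T x < t} \<union> {x\<in>K. T x = t}" by auto
  then have "card {x\<in>K. T x \<le> t} = card {x\<in>K. T x < t} + card {x\<in>K. T x = t}"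
    using fin by (simp add: card_Un_disjoint disjoint_iff)
  then show "card (G ` {x\<in>K. T x = t}) = card {card {x\<in>K. T x < t} + 1..card {x\<in>K. T x \<le> t}}"
    by (simp add: card_image[OF inj])
qed simp

subsection \<open>Product models\<close>

text \<open>With \<open>v = exp (u a)\<close> in \<open>[1, e]\<close>,
  \<open>(v - 1) * (v - e) \<le> 0\<close> gives \<open>v + e / v \<le> 1 + e\<close>. Averaging,
  and then comparing arithmetic and geometric means, yields the constant
  \<open>(1 + e)^2 / (4 * e)\<close>, which is below 1.3.\<close>

lemma Kantorovich_exp:
  fixes q u :: "'b \<Rightarrow> real"
  assumes q: "\<And>a. a \<in> B \<Longrightarrow> q a \<ge> 0" and u: "\<And>a. a \<in> B \<Longrightarrow> 0 \<le> u a \<and> u a \<le> 1"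
  shows "(\<Sum>a\<in>B. q a * exp (u a)) * (\<Sum>a\<in>B. q a * exp (- u a)) \<le> 13 / 10 * (sum q B)\<^sup>2"
proof -
  define e where "e = exp (1::real)"
  define X Y Q where "X = (\<Sum>a\<in>B. q a * exp (u a))" and "Y = (\<Sum>a\<in>B. q a * exp (- u a))"
    and "Q = sum q B"
  have e: "2 \<le> e" "e \<le> 272/100" using exp_ge_add_one_self[of 1] e_less_272 by (auto simp: e_def)
  have "X + e * Y = (\<Sum>a\<in>B. q a * (exp (u a) + e * exp (- u a)))"
    by (simp add: X_def Y_def sum.distrib sum_distrib_left algebra_simps)
  also have "\<dots> \<le> (\<Sum>a\<in>B. q a * (1 + e))"
  proof (intro sum_mono mult_left_mono)
    fix a assume a: "a \<in> B"
    define v where "v = exp (u a)"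
    have v: "1 \<le> v" "v \<le> e" using u[OF a] by (auto simp: v_def e_def)
    have "(v - 1) * (v - e) \<le> 0" using v by (intro mult_nonneg_nonpos) auto
    then have "(v * v + e) / v \<le> 1 + e" using v by (subst pos_divide_le_eq) (auto simp: algebra_simps)
    moreover have "(v * v + e) / v = v + e * inverse v" using v by (simp add: field_simps)
    ultimately show "exp (u a) + e * exp (- u a) \<le> 1 + e" by (simp add: exp_minus flip: v_def)
  qed (use q in auto)
  also have "\<dots> = (1 + e) * Q" by (simp add: Q_def sum_distrib_left mult.commute)
  finally have "X + e * Y \<le> (1 + e) * Q" .
  moreover have nn: "0 \<le> X" "0 \<le> Y" using q by (auto simp: X_def Y_def intro!: sum_nonneg)
  ultimately have "(X + e * Y)\<^sup>2 \<le> ((1 + e) * Q)\<^sup>2" using e by (intro power_mono) auto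
  \<comment> \<open>Here \<open>4 * e * X * Y\<close> is \<open>(X + e * Y)^2\<close> minus the
    square of \<open>X - e * Y\<close>.\<close>
  then have "4 * e * (X * Y) \<le> (1 + e)\<^sup>2 * Q\<^sup>2"
    using sum_squares_ge_zero[of "X - e * Y" 0] by (simp add: power2_eq_square algebra_simps)
  also have "\<dots> \<le> (4 * e * (13 / 10)) * Q\<^sup>2"
  proof (intro mult_right_mono)
    have "(e - 2) * (e - 272/100) \<le> 0" using e by (intro mult_nonneg_nonpos) auto
    moreover have "(e - 2) * (e - 272/100) = e\<^sup>2 - 118/25 * e + 136/25"
      by (simp add: power2_eq_square field_simps)
    moreover have "(1 + e)\<^sup>2 = 1 + 2 * e + e\<^sup>2" by (simp add: power2_sum)
    ultimately show "(1 + e)\<^sup>2 \<le> 4 * e * (13 / 10)" using e by linarith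
  qed auto
  finally have "4 * e * (X * Y) \<le> 4 * e * (13 / 10 * Q\<^sup>2)" by simp
  then show ?thesis using e unfolding X_def Y_def Q_def by (subst (asm) mult_le_cancel_left_pos) auto
qed

text \<open>One instance at a fixed \<open>m\<close>. All estimates inside are explicit; the limit
  in \<open>m\<close> is taken only in the final theorem.\<close>

locale key_model =
  fixes m :: nat and A :: "nat \<Rightarrow> 'a set" and p :: "nat \<Rightarrow> 'a pmf"
  assumes finite_A: "\<And>i. i \<in> {1..m} \<Longrightarrow> finite (A i)"
    and set_pmf_A: "\<And>i. i \<in> {1..m} \<Longrightarrow> set_pmf (p i) \<subseteq> A i"
    and pmf_pos: "\<And>i a. i \<in> {1..m} \<Longrightarrow> a \<in> A i \<Longrightarrow> pmf (p i) a > 0"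
begin

abbreviation "K \<equiv> keys m A"
abbreviation "S \<equiv> total_surprisal m p"
abbreviation "N \<equiv> real (card K)"
abbreviation "loglog \<equiv> ln (1 + ln N)"

lemma finite_keys: "finite K"
  unfolding keys_def using finite_A by (intro finite_PiE) auto

lemma A_nonempty: "i \<in> {1..m} \<Longrightarrow> A i \<noteq> {}"
  using set_pmf_A set_pmf_not_empty by fastforce

lemma keys_nonempty: "K \<noteq> {}"
  unfolding keys_def using A_nonempty by (simp add: PiE_eq_empty_iff)

lemma N_ge_1: "N \<ge> 1"
  using finite_keys keys_nonempty by (simp add: Suc_leI card_gt_0_iff)

lemma in_A: "x \<in> K \<Longrightarrow> i \<in> {1..m} \<Longrightarrow> x i \<in> A i"
  unfolding keys_def by (rule PiE_mem)

lemma surprisal_exp: "i \<in> {1..m} \<Longrightarrow> a \<in> A i \<Longrightarrow> exp (- surprisal p i a) = pmf (p i) a"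
  using pmf_pos by (simp add: surprisal_def)

lemma pmf_key_law: "x \<in> K \<Longrightarrow> pmf (key_law m p) x = exp (- S x)"
proof -
  assume x: "x \<in> K"
  have "pmf (key_law m p) x = (\<Prod>i\<in>{1..m}. pmf (p i) (x i))"
    unfolding key_law_def using x by (intro pmf_Pi') (auto simp: keys_def PiE_def extensional_def)
  also have "\<dots> = (\<Prod>i\<in>{1..m}. exp (- surprisal p i (x i)))"
    by (intro prod.cong refl surprisal_exp[symmetric] in_A[OF x]) auto
  also have "\<dots> = exp (- S x)"
    unfolding total_surprisal_def sum_negf[symmetric] by (rule exp_sum[symmetric]) simp
  finally show ?thesis .
qed

lemma set_pmf_key_law: "set_pmf (key_law m p) \<subseteq> K"
proof -
  have "set_pmf (key_law m p) \<subseteq> PiE_dflt {1..m} undefined (set_pmf \<circ> p)"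
    unfolding key_law_def by (rule set_Pi_pmf_subset') simp
  also have "\<dots> \<subseteq> PiE_dflt {1..m} undefined A"
    using set_pmf_A by (auto simp: PiE_dflt_def)
  also have "\<dots> = K"
    by (auto simp: PiE_dflt_def keys_def PiE_def Pi_def extensional_def)
  finally show ?thesis .
qed

lemma expectation_key_law:
  fixes f :: "(nat \<Rightarrow> 'a) \<Rightarrow> real"
  shows "measure_pmf.expectation (key_law m p) f = (\<Sum>x\<in>K. exp (- S x) * f x)"
  using set_pmf_key_law
  by (subst integral_measure_pmf_real[OF finite_keys]) (auto simp: pmf_key_law mult.commute)

lemma prob_key_law:
  "measure_pmf.prob (key_law m p) {x. T x = t} = (\<Sum>x\<in>{x\<in>K. T x = t}. exp (- S x))"
proof -
  have "measure_pmf.prob (key_law m p) {x. T x = t}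
      = measure_pmf.expectation (key_law m p) (indicator {x. T x = t})"
    by simp
  also have "\<dots> = (\<Sum>x\<in>K. if T x = t then exp (- S x) else 0)"
    unfolding expectation_key_law by (intro sum.cong) (auto simp: indicator_def)
  finally show ?thesis using finite_keys by (simp add: sum.inter_filter)
qed

lemma prob_key_unif: "N * measure_pmf.prob (key_unif m A) X = real (card {x\<in>K. x \<in> X})"
  unfolding key_unif_def using finite_keys keys_nonempty
  by (simp add: measure_pmf_of_set Int_def)

lemma sum_exp_neg_surprisal: "(\<Sum>x\<in>K. exp (- S x)) = 1"
  using expectation_key_law[of "\<lambda>_. 1"] by simp

lemma guess_order_iff: "guess_order m A p G \<longleftrightarrow> guessing_order K S G"
  by (simp add: guess_order_def guessing_order_def)

lemma guess_f_eq: "guess_f m p G \<rho> = ln (\<Sum>x\<in>K. exp (- S x) * real (G x) powr \<rho>)"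
  by (simp add: guess_f_def expectation_key_law)

text \<open>Any order sorted by the binned surprisal fills each level with the same block of ranks.
  The order within ties is therefore free to be chosen later.\<close>

lemma bin_avg_eq:
  assumes H: "guessing_order K (total_binned m p \<eta>) H" and x: "x \<in> K"
  shows "bin_avg m A p \<eta> \<rho> (total_binned m p \<eta> x)
    = tie_average K (total_binned m p \<eta>) (\<lambda>x. real (H x) powr \<rho>) x"
proof -
  let ?T = "total_binned m p \<eta>" and ?t = "total_binned m p \<eta> x"
  let ?R = "{r::nat. N * bin_F_left m A p \<eta> ?t + 1 \<le> real r \<and> real r \<le> N * bin_F m A p \<eta> ?t}"
  have "?R = {card {y\<in>K. ?T y < ?t} + 1..card {y\<in>K. ?T y \<le> ?t}}"
    unfolding bin_F_left_def bin_F_def prob_key_unif by auto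
  also have "\<dots> = H ` {y\<in>K. ?T y = ?t}"
    using guessing_order_image_level[OF finite_keys H] by simp
  finally have R: "?R = H ` {y\<in>K. ?T y = ?t}" .
  have "inj_on H {y\<in>K. ?T y = ?t}"
    using H by (auto simp: guessing_order_def bij_betw_def inj_on_def)
  then show ?thesis
    unfolding bin_avg_def Let_def R tie_average_def bin_nu_def prob_key_unif
    by (simp add: sum.reindex)
qed

lemma binned_f_eq:
  assumes "guessing_order K (total_binned m p \<eta>) H"
  shows "binned_f m A p \<eta> \<rho> =
    ln (\<Sum>x\<in>K. exp (- S x) * tie_average K (total_binned m p \<eta>) (\<lambda>x. real (H x) powr \<rho>) x)"
proof -
  let ?T = "total_binned m p \<eta>"
  have "(\<Sum>t\<in>?T ` K. bin_pi m p \<eta> t * bin_avg m A p \<eta> \<rho> t)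
     = (\<Sum>t\<in>?T ` K. \<Sum>x\<in>{x\<in>K. ?T x = t}. exp (- S x) * bin_avg m A p \<eta> \<rho> (?T x))"
    unfolding bin_pi_def prob_key_law by (intro sum.cong refl) (simp add: sum_distrib_right)
  also have "\<dots> = (\<Sum>x\<in>K. exp (- S x) * bin_avg m A p \<eta> \<rho> (?T x))"
    by (rule sum.image_gen[OF finite_keys, symmetric])
  finally show ?thesis unfolding binned_f_def by (simp add: bin_avg_eq[OF assms])
qed

lemma sum_keys_prod:
  fixes f :: "nat \<Rightarrow> 'a \<Rightarrow> real"
  shows "(\<Sum>x\<in>K. \<Prod>i\<in>{1..m}. f i (x i)) = (\<Prod>i\<in>{1..m}. \<Sum>a\<in>A i. f i a)"
  unfolding keys_def using finite_A by (intro prod_sum_PiE[symmetric]) auto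

text \<open>The normaliser of the law proportional to \<open>exp (- \<alpha> * S x)\<close>; it
  factorises over coordinates, and its logarithm is a sum of Renyi entropies up to scaling.\<close>

definition partition_fn :: "real \<Rightarrow> real" where
  "partition_fn \<alpha> = (\<Sum>x\<in>K. exp (- \<alpha> * S x))"

lemma partition_fn_pos: "partition_fn \<alpha> > 0"
  unfolding partition_fn_def using finite_keys keys_nonempty by (intro sum_pos) auto

lemma partition_fn_prod: "partition_fn \<alpha> = (\<Prod>i\<in>{1..m}. \<Sum>a\<in>A i. exp (- \<alpha> * surprisal p i a))"
proof -
  have "exp (- \<alpha> * S x) = (\<Prod>i\<in>{1..m}. exp (- \<alpha> * surprisal p i (x i)))" for x
    unfolding total_surprisal_def sum_distrib_left by (rule exp_sum) simp
  then show ?thesis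
    using sum_keys_prod[of "\<lambda>i a. exp (- \<alpha> * surprisal p i a)"] by (simp add: partition_fn_def)
qed

text \<open>For \<open>\<alpha> = 1 / (1 + \<rho>)\<close> the Renyi prefactor
  \<open>1 / (1 - \<alpha>)\<close> equals \<open>(1 + \<rho>) / \<rho>\<close>, and the logarithm
  of the product is additive over coordinates.\<close>

lemma ln_partition_fn:
  assumes "m \<ge> 1" "\<rho> > 0"
  shows "(1 + \<rho>) * ln (partition_fn (1 / (1 + \<rho>))) = \<rho> * (real m * mean_renyi m A p (1 / (1 + \<rho>)))"
proof -
  define \<alpha> where "\<alpha> = 1 / (1 + \<rho>)"
  have \<alpha>: "\<alpha> \<noteq> 1" "\<rho> * (1 / (1 - \<alpha>)) = 1 + \<rho>" using \<open>\<rho> > 0\<close> by (auto simp: \<alpha>_def field_simps)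
  have p: "(\<Sum>a\<in>A i. pmf (p i) a powr \<alpha>) = (\<Sum>a\<in>A i. exp (- \<alpha> * surprisal p i a))"
    if "i \<in> {1..m}" for i
    using pmf_pos[OF that] by (intro sum.cong refl) (force simp: powr_def surprisal_def)
  have pos: "(\<Sum>a\<in>A i. exp (- \<alpha> * surprisal p i a)) > 0" if "i \<in> {1..m}" for i
    using finite_A[OF that] A_nonempty[OF that] by (intro sum_pos) auto
  have "\<rho> * (real m * mean_renyi m A p \<alpha>) = (\<Sum>i=1..m. \<rho> * renyi (A i) (p i) \<alpha>)"
    using \<open>m \<ge> 1\<close> by (simp add: mean_renyi_def sum_distrib_left)
  also have "\<dots> = (\<Sum>i=1..m. (1 + \<rho>) * ln (\<Sum>a\<in>A i. exp (- \<alpha> * surprisal p i a)))"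
    using \<alpha> p by (intro sum.cong refl) (simp add: renyi_def flip: \<alpha>(2))
  also have "\<dots> = (1 + \<rho>) * ln (partition_fn \<alpha>)"
    unfolding partition_fn_prod using less_imp_neq[OF pos] by (subst ln_prod) (force simp: sum_distrib_left)+
  finally show ?thesis unfolding \<alpha>_def ..
qed

lemma mean_renyi_1_nonneg: "mean_renyi m A p 1 \<ge> 0"
proof -
  have "renyi (A i) (p i) 1 \<ge> 0" if "i \<in> {1..m}" for i
    using pmf_pos[OF that] pmf_le_1 by (auto simp: renyi_def intro!: sum_nonpos mult_nonneg_nonpos)
  then show ?thesis unfolding mean_renyi_def by (intro mult_nonneg_nonneg sum_nonneg) auto
qed

lemma moment_pos:
  assumes "bij_betw G K {1..card K}"
  shows "(\<Sum>x\<in>K. exp (- S x) * real (G x) powr \<rho>) > 0"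
  using bij_betwE[OF assms] finite_keys keys_nonempty by (intro sum_pos) fastforce+

text \<open>The logarithm of \<open>guessing_moment_lower\<close>. At \<open>\<rho> = 1/2\<close>,
  hence Renyi order 2/3, it keeps the denominators of both ratios away from 0.\<close>

lemma guess_f_lower:
  assumes G: "bij_betw G K {1..card K}" and "m \<ge> 1" "\<rho> > 0"
  shows "guess_f m p G \<rho> \<ge> \<rho> * (real m * mean_renyi m A p (1 / (1 + \<rho>)) - loglog)"
proof -
  let ?M = "\<Sum>x\<in>K. exp (- S x) * real (G x) powr \<rho>"
  have l: "1 + ln N > 0" using N_ge_1 by (auto intro: add_pos_nonneg)
  have "partition_fn (1 / (1 + \<rho>)) powr (1 + \<rho>) \<le> (1 + ln N) powr \<rho> * ?M"
    unfolding partition_fn_def by (rule guessing_moment_lower[OF finite_keys keys_nonempty G \<open>\<rho> > 0\<close>])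
  then have "ln (partition_fn (1 / (1 + \<rho>)) powr (1 + \<rho>)) \<le> ln ((1 + ln N) powr \<rho> * ?M)"
    using partition_fn_pos[of "1 / (1 + \<rho>)"] moment_pos[OF G, of \<rho>] l by (subst ln_le_cancel_iff) auto
  then have "(1 + \<rho>) * ln (partition_fn (1 / (1 + \<rho>))) \<le> \<rho> * loglog + ln ?M"
    using partition_fn_pos[of "1 / (1 + \<rho>)"] moment_pos[OF G, of \<rho>] l by (simp add: ln_mult ln_powr)
  then show ?thesis
    unfolding guess_f_eq ln_partition_fn[OF \<open>m \<ge> 1\<close> \<open>\<rho> > 0\<close>] by (simp add: algebra_simps)
qed

lemma guess_f_nonneg:
  assumes G: "bij_betw G K {1..card K}" and "\<rho> \<ge> 0"
  shows "guess_f m p G \<rho> \<ge> 0"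
proof -
  have "1 = (\<Sum>x\<in>K. exp (- S x) * 1)" using sum_exp_neg_surprisal by simp
  also have "\<dots> \<le> (\<Sum>x\<in>K. exp (- S x) * real (G x) powr \<rho>)"
    using bij_betwE[OF G] \<open>\<rho> \<ge> 0\<close> by (intro sum_mono mult_left_mono ge_one_powr_ge_zero) auto
  finally show ?thesis unfolding guess_f_eq by simp
qed

section \<open>The binning error and its exponential moments under product weights\<close>

definition bin_error :: "real \<Rightarrow> nat \<Rightarrow> 'a \<Rightarrow> real" where
  "bin_error \<eta> i a = binned_surprisal p \<eta> i a - surprisal p i a"

definition total_bin_error :: "real \<Rightarrow> (nat \<Rightarrow> 'a) \<Rightarrow> real" where
  "total_bin_error \<eta> x = (\<Sum>i=1..m. bin_error \<eta> i (x i))"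

lemma total_binned_eq: "total_binned m p \<eta> x = S x + total_bin_error \<eta> x"
  by (simp add: total_binned_def total_surprisal_def total_bin_error_def bin_error_def sum_subtractf)

lemma bin_error_bounds:
  assumes "\<eta> > 0" shows "0 \<le> bin_error \<eta> i a" "bin_error \<eta> i a \<le> \<eta>"
proof -
  let ?z = "surprisal p i a / \<eta>"
  have "bin_error \<eta> i a = \<eta> * (real_of_int \<lfloor>?z\<rfloor> + 1 - ?z)"
    using assms by (simp add: bin_error_def binned_surprisal_def algebra_simps)
  moreover have "0 \<le> real_of_int \<lfloor>?z\<rfloor> + 1 - ?z" "real_of_int \<lfloor>?z\<rfloor> + 1 - ?z \<le> 1"
    by linarith+
  ultimately show "0 \<le> bin_error \<eta> i a" "bin_error \<eta> i a \<le> \<eta>"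
    using assms by (auto simp: mult_left_le)
qed

lemma total_bin_error_bounds:
  assumes "\<eta> > 0" shows "0 \<le> total_bin_error \<eta> x" "total_bin_error \<eta> x \<le> real m * \<eta>"
  unfolding total_bin_error_def using bin_error_bounds[OF assms]
    sum_bounded_above[of "{1..m}" "\<lambda>i. bin_error \<eta> i (x i)" \<eta>] by (auto intro: sum_nonneg)

lemma tilted_error_mgf:
  "(\<Sum>x\<in>K. exp (- \<alpha> * S x) * exp (c * total_bin_error \<eta> x))
    = (\<Prod>i\<in>{1..m}. \<Sum>a\<in>A i. exp (- \<alpha> * surprisal p i a) * exp (c * bin_error \<eta> i a))"
proof -
  have "exp (- \<alpha> * S x) * exp (c * total_bin_error \<eta> x)
      = (\<Prod>i\<in>{1..m}. exp (- \<alpha> * surprisal p i (x i)) * exp (c * bin_error \<eta> i (x i)))" for x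
    unfolding total_surprisal_def total_bin_error_def sum_distrib_left prod.distrib
    by (simp only: exp_sum finite_atLeastAtMost)
  then show ?thesis using sum_keys_prod[of "\<lambda>i a. exp (- \<alpha> * surprisal p i a) * exp (c * bin_error \<eta> i a)"] by simp
qed

text \<open>Both sums factorise, and \<open>Kantorovich_exp\<close> applies in each coordinate,
  where the error divided by \<open>\<eta>\<close> lies in \<open>[0, 1]\<close>.\<close>

lemma tilted_error_Kantorovich:
  assumes "\<eta> > 0"
  shows "(\<Sum>x\<in>K. exp (- \<alpha> * S x) * exp (total_bin_error \<eta> x / \<eta>))
       * (\<Sum>x\<in>K. exp (- \<alpha> * S x) * exp (- total_bin_error \<eta> x / \<eta>))
     \<le> (13 / 10) ^ m * (partition_fn \<alpha>)\<^sup>2"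
proof -
  let ?q = "\<lambda>i a. exp (- \<alpha> * surprisal p i a)" and ?u = "\<lambda>i a. bin_error \<eta> i a / \<eta>"
  have "(\<Sum>x\<in>K. exp (- \<alpha> * S x) * exp (total_bin_error \<eta> x / \<eta>))
       * (\<Sum>x\<in>K. exp (- \<alpha> * S x) * exp (- total_bin_error \<eta> x / \<eta>))
     = (\<Prod>i\<in>{1..m}. (\<Sum>a\<in>A i. ?q i a * exp (?u i a)) * (\<Sum>a\<in>A i. ?q i a * exp (- ?u i a)))"
    using tilted_error_mgf[of \<alpha> "1 / \<eta>" \<eta>] tilted_error_mgf[of \<alpha> "- 1 / \<eta>" \<eta>]
    by (simp add: prod.distrib)
  also have "\<dots> \<le> (\<Prod>i\<in>{1..m}. 13 / 10 * (\<Sum>a\<in>A i. ?q i a)\<^sup>2)"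
    using bin_error_bounds[OF assms] assms
    by (intro prod_mono conjI Kantorovich_exp mult_nonneg_nonneg sum_nonneg) auto
  also have "\<dots> = (13 / 10) ^ m * (partition_fn \<alpha>)\<^sup>2"
    unfolding partition_fn_prod prod.distrib prod_power_distrib by simp
  finally show ?thesis .
qed

end

subsection \<open>Comparison of the binned and the exact moments\<close>

text \<open>These are the conditions that \<open>guessing_weight_tilt\<close> places on
  \<open>B\<close>, for ranks averaged over ties.\<close>

lemma tie_average_rank_bounds:
  assumes fin: "finite K" and H: "guessing_order K T H" and x: "x \<in> K" and "\<rho> \<ge> 0"
  shows "tie_average K T (\<lambda>y. real (H y) powr \<rho>) x > 0"
    and "tie_average K T (\<lambda>y. real (H y) powr \<rho>) x \<le> real (card {y\<in>K. T y \<le> T x}) powr \<rho>"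
proof -
  let ?B = "{y\<in>K. T y = T x}" and ?c = "real (card {y\<in>K. T y \<le> T x}) powr \<rho>"
  have B: "finite ?B" "?B \<noteq> {}" using fin x by auto
  then have n: "real (card ?B) > 0" by (simp add: card_gt_0_iff)
  have "H y > 0" if "y \<in> K" for y
    using H that by (auto simp: guessing_order_def dest!: bij_betwE)
  then have "(\<Sum>y\<in>?B. real (H y) powr \<rho>) > 0" using B by (intro sum_pos) auto
  then show "tie_average K T (\<lambda>y. real (H y) powr \<rho>) x > 0"
    using n unfolding tie_average_def by simp
  have "real (H y) powr \<rho> \<le> ?c" if "y \<in> ?B" for y
    using guessing_order_le_card[OF fin H, of y] that \<open>\<rho> \<ge> 0\<close> by (intro powr_mono2) auto
  then have "(\<Sum>y\<in>?B. real (H y) powr \<rho>) \<le> real (card ?B) * ?c"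
    by (intro sum_bounded_above) auto
  then show "tie_average K T (\<lambda>y. real (H y) powr \<rho>) x \<le> ?c"
    using n unfolding tie_average_def by (simp add: pos_divide_le_eq mult.commute)
qed

context key_model
begin

text \<open>The lower bound combines optimality of \<open>G\<close> with Chebyshev's inequality on
  ties. The upper bound passes from weight \<open>exp (- S)\<close> to \<open>exp (- T)\<close>,
  exchanges \<open>H\<close> for \<open>G\<close> there by optimality of \<open>H\<close>, and
  passes back.\<close>

lemma binned_f_bounds:
  assumes G: "guessing_order K S G" and "\<rho> > 0" and \<eta>: "0 < \<eta>" "\<eta> \<le> 1"
  shows "guess_f m p G \<rho> \<le> binned_f m A p \<eta> \<rho>"
    and "binned_f m A p \<eta> \<rho> \<le> guess_f m p G \<rho> + \<eta> * (2 * \<rho> * loglog + real m * \<eta> + 3 / 10 * real m)"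
proof -
  define T D where "T = total_binned m p \<eta>" and "D = total_bin_error \<eta>"
  have T: "T x = S x + D x" for x by (simp add: T_def D_def total_binned_eq)
  have D: "0 \<le> D x" "D x \<le> real m * \<eta>" for x
    using total_bin_error_bounds[OF \<eta>(1)] by (auto simp: D_def)
  have bijG: "bij_betw G K {1..card K}" using G by (simp add: guessing_order_def)
  obtain H where H: "guessing_order K T H"
    and tie: "\<And>x y. x \<in> K \<Longrightarrow> y \<in> K \<Longrightarrow> T x = T y \<Longrightarrow> H x \<le> H y \<Longrightarrow> G x \<le> G y"
    using guessing_order_refine[OF finite_keys, of G T] bijG by (auto simp: bij_betw_def)
  have bijH: "bij_betw H K {1..card K}" using H by (simp add: guessing_order_def)
  define c where "c r = real r powr \<rho>" for r :: nat
  have c: "mono c" using \<open>\<rho> > 0\<close> by (auto simp: c_def mono_def intro!: powr_mono2)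
  define B where "B = tie_average K T (\<lambda>x. c (H x))"
  have B: "B x > 0" "B x \<le> real (card {y\<in>K. T y \<le> T x}) powr \<rho>" if "x \<in> K" for x
    using tie_average_rank_bounds[OF finite_keys H that, of \<rho>] \<open>\<rho> > 0\<close> by (auto simp: B_def c_def)
  define M where "M = (\<Sum>x\<in>K. exp (- S x) * c (G x))"
  define M' where "M' = (\<Sum>x\<in>K. exp (- S x) * B x)"
  have f: "guess_f m p G \<rho> = ln M" by (simp add: guess_f_eq M_def c_def)
  have f': "binned_f m A p \<eta> \<rho> = ln M'"
    using binned_f_eq[OF H[unfolded T_def]] by (simp add: M'_def B_def c_def T_def)
  have M: "M > 0" using moment_pos[OF bijG] by (simp add: M_def c_def)

  have "M \<le> (\<Sum>x\<in>K. exp (- S x) * c (H x))"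
    unfolding M_def by (rule guessing_order_optimal[OF finite_keys G bijH c])
  also have "\<dots> \<le> M'"
    unfolding M'_def B_def
  proof (rule sum_le_tie_average[OF finite_keys])
    \<comment> \<open>Within a tie class \<open>H\<close> follows \<open>G\<close>, which sorts by
      \<open>S\<close>; so later ranks carry smaller weights.\<close>
    have *: "exp (- S x) \<ge> exp (- S y) \<and> c (H x) \<le> c (H y)"
      if "x \<in> K" "y \<in> K" "T x = T y" "H x \<le> H y" for x y
      using tie[OF that] G that c by (auto simp: guessing_order_def mono_def)
    fix x y assume xy: "x \<in> K" "y \<in> K" "T x = T y"
    show "(exp (- S x) - exp (- S y)) * (c (H x) - c (H y)) \<le> 0"
      using *[OF xy] *[of y x] xy by (cases "H x \<le> H y") (auto simp: mult_le_0_iff)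
  qed
  finally have MM': "M \<le> M'" .
  then show "guess_f m p G \<rho> \<le> binned_f m A p \<eta> \<rho>" unfolding f f' using M by simp

  define \<alpha> where "\<alpha> = 1 / (1 + \<rho>)"
  have \<alpha>: "0 < \<alpha>" "\<alpha> \<le> 1" using \<open>\<rho> > 0\<close> by (auto simp: \<alpha>_def)
  define L where "L = (1 + ln N) powr \<rho>"
  have l: "1 + ln N > 0" using N_ge_1 by (auto intro: add_pos_nonneg)
  then have L: "L > 0" by (simp add: L_def)
  define Z where "Z = partition_fn \<alpha>"
  define Z' where "Z' = (\<Sum>x\<in>K. exp (- \<alpha> * T x))"
  define X where "X = (\<Sum>x\<in>K. exp (- \<alpha> * S x) * exp (D x / \<eta>))"
  define X' where "X' = (\<Sum>x\<in>K. exp (- \<alpha> * T x) * exp (D x / \<eta>))"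
  define Y where "Y = (\<Sum>x\<in>K. exp (- \<alpha> * S x) * exp (- D x / \<eta>))"
  have pos: "Z > 0" "Z' > 0" "X > 0" "X' > 0" "Y > 0"
    unfolding Z_def partition_fn_def Z'_def X_def X'_def Y_def
    using finite_keys keys_nonempty by (auto intro!: sum_pos)
  define V where "V = (\<Sum>x\<in>K. exp (- T x) * B x)"
  \<comment> \<open>Since \<open>exp (- T x)\<close> is constant on ties, the averaged moment is the
    true moment of \<open>H\<close>, to which optimality and the lower bound apply.\<close>
  have V: "V = (\<Sum>x\<in>K. exp (- T x) * c (H x))"
    unfolding V_def B_def using sum_tie_average[OF finite_keys, where w = "\<lambda>t. exp (- t)"] by simp

  \<comment> \<open>First change of weight, with \<open>h = \<eta>\<close>: the error appears as
    \<open>D x / \<eta>\<close>, the scale on which each coordinate contributes at most 1.\<close>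
  have "M' = (\<Sum>x\<in>K. exp (- T x) * B x * exp (D x))"
    unfolding M'_def T by (intro sum.cong refl) (simp add: mult.commute mult.left_commute flip: exp_add)
  also have "\<dots> \<le> V * (L * (X' / Z')) powr \<eta>"
    unfolding V_def L_def X'_def Z'_def
  proof (rule guessing_weight_tilt[OF finite_keys keys_nonempty \<open>\<rho> > 0\<close> \<alpha>_def B _ \<eta>])
    show "(\<Sum>x\<in>K. exp (- \<alpha> * T x)) powr (1 + \<rho>) \<le> (1 + ln N) powr \<rho> * (\<Sum>x\<in>K. exp (- T x) * B x)"
      unfolding V_def[symmetric] V c_def \<alpha>_def
      by (rule guessing_moment_lower[OF finite_keys keys_nonempty bijH \<open>\<rho> > 0\<close>])
  qed
  finally have M'_le: "M' \<le> V * (L * (X' / Z')) powr \<eta>" .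

  have "V \<le> (\<Sum>x\<in>K. exp (- T x) * c (G x))"
    unfolding V by (rule guessing_order_optimal[OF finite_keys H bijG c])
  also have "\<dots> = (\<Sum>x\<in>K. exp (- S x) * c (G x) * exp (- D x))"
    unfolding T by (intro sum.cong refl) (simp add: mult.commute mult.left_commute flip: exp_add)
  also have "\<dots> \<le> M * (L * (Y / Z)) powr \<eta>"
    unfolding M_def L_def Y_def Z_def partition_fn_def
  proof (rule guessing_weight_tilt[OF finite_keys keys_nonempty \<open>\<rho> > 0\<close> \<alpha>_def _ _ _ \<eta>])
    fix x assume x: "x \<in> K"
    show "c (G x) > 0" using bijG x by (auto simp: c_def dest!: bij_betwE)
    show "c (G x) \<le> real (card {y\<in>K. S y \<le> S x}) powr \<rho>"
      unfolding c_def using guessing_order_le_card[OF finite_keys G x] \<open>\<rho> > 0\<close> by (intro powr_mono2) auto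
  next
    show "(\<Sum>x\<in>K. exp (- \<alpha> * S x)) powr (1 + \<rho>) \<le> (1 + ln N) powr \<rho> * (\<Sum>x\<in>K. exp (- S x) * c (G x))"
      unfolding c_def \<alpha>_def by (rule guessing_moment_lower[OF finite_keys keys_nonempty bijG \<open>\<rho> > 0\<close>])
  qed
  finally have V_le: "V \<le> M * (L * (Y / Z)) powr \<eta>" .

  \<comment> \<open>Kantorovich's inequality needs \<open>X\<close> and \<open>Y\<close> under one
    product weight. Replacing \<open>T\<close> by \<open>S\<close> in \<open>X'\<close> and
    \<open>Z'\<close> costs at most a factor \<open>exp (m * \<eta>)\<close>.\<close>
  have X'X: "X' \<le> X"
    unfolding X'_def X_def T using \<alpha> D by (intro sum_mono mult_right_mono) (auto simp: mult_left_mono)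
  have ZZ': "Z \<le> exp (real m * \<eta>) * Z'"
    unfolding Z_def partition_fn_def Z'_def sum_distrib_left
  proof (intro sum_mono)
    fix x
    have "\<alpha> * D x \<le> real m * \<eta>" using mult_mono[OF \<alpha>(2) D(2)[of x]] D(1)[of x] by simp
    then have "- \<alpha> * S x \<le> real m * \<eta> + (- \<alpha> * T x)" unfolding T by (simp add: algebra_simps)
    then show "exp (- \<alpha> * S x) \<le> exp (real m * \<eta>) * exp (- \<alpha> * T x)" by (simp only: exp_add[symmetric] exp_le_cancel_iff)
  qed
  have XY: "X * Y \<le> (13 / 10) ^ m * Z\<^sup>2"
    using tilted_error_Kantorovich[OF \<eta>(1)] by (simp add: X_def Y_def Z_def D_def)
  have "M' \<le> M * (L * (Y / Z)) powr \<eta> * (L * (X' / Z')) powr \<eta>"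
    using M'_le V_le by (rule order_trans[OF _ mult_right_mono]) simp
  then have "ln M' \<le> ln (M * (L * (Y / Z)) powr \<eta> * (L * (X' / Z')) powr \<eta>)"
    using M MM' by simp
  also have "\<dots> = ln M + \<eta> * (2 * ln L + ln X' + ln Y - ln Z - ln Z')"
    using M L pos by (simp add: ln_mult ln_div ln_powr algebra_simps)
  also have "\<dots> \<le> ln M + \<eta> * (2 * \<rho> * loglog + real m * \<eta> + 3 / 10 * real m)"
  proof -
    have "ln X' \<le> ln X" using X'X pos by simp
    moreover have "ln Z \<le> real m * \<eta> + ln Z'"
      using ZZ' pos by (metis exp_gt_zero ln_exp ln_le_cancel_iff ln_mult_pos mult_pos_pos)
    moreover have "ln X + ln Y \<le> 3 / 10 * real m + 2 * ln Z"
    proof -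
      have "ln (X * Y) \<le> ln ((13 / 10) ^ m * Z\<^sup>2)" using XY pos by simp
      also have "\<dots> = real m * ln (13 / 10) + 2 * ln Z" using pos by (simp add: ln_mult ln_realpow)
      \<comment> \<open>The coefficient 3/10 is the bound
        \<open>ln (13 / 10) \<le> 13 / 10 - 1\<close>.\<close>
      also have "\<dots> \<le> real m * (3 / 10) + 2 * ln Z"
        using ln_le_minus_one[of "13 / 10"] by (intro add_right_mono mult_left_mono) auto
      finally show ?thesis using pos by (simp add: ln_mult)
    qed
    moreover have "ln L = \<rho> * loglog" using l by (simp add: L_def ln_powr)
    ultimately have "2 * ln L + ln X' + ln Y - ln Z - ln Z' \<le> 2 * \<rho> * loglog + real m * \<eta> + 3 / 10 * real m"
      by simp
    then show ?thesis using \<eta> by (intro add_left_mono mult_left_mono) auto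
  qed
  finally show "binned_f m A p \<eta> \<rho> \<le> guess_f m p G \<rho> + \<eta> * (2 * \<rho> * loglog + real m * \<eta> + 3 / 10 * real m)"
    unfolding f f' .
qed

text \<open>A quotient perturbation estimate: numerator and denominator both grow by at most
  \<open>E\<close>, and the denominator is at least of order \<open>m\<close>.\<close>

lemma binned_s_error:
  assumes G: "guessing_order K S G" and "m \<ge> 1" and \<eta>: "0 < \<eta>" "\<eta> \<le> 1 / 20"
    and g: "0 < g" "g \<le> mean_renyi m A p (2/3)"
    and ll: "loglog \<le> real m / 40" "loglog \<le> g / 10 * real m"
  shows "\<bar>binned_s m A p \<eta> - guess_s m p G\<bar> \<le> (2 + guess_s m p G) / mean_renyi m A p (2/3) * \<eta>"
proof -
  define h where "h = mean_renyi m A p (2/3)"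
  define a b a' b' where "a = guess_f m p G 1" and "b = guess_f m p G (1/2)"
    and "a' = binned_f m A p \<eta> 1" and "b' = binned_f m A p \<eta> (1/2)"
  have h: "h > 0" using g by (simp add: h_def)
  have m: "real m > 0" using \<open>m \<ge> 1\<close> by simp
  have bij: "bij_betw G K {1..card K}" using G by (simp add: guessing_order_def)
  have ll0: "loglog \<ge> 0" using N_ge_1 by simp
  \<comment> \<open>The three contributions are at most \<open>m/20\<close>, \<open>m/20\<close> and
    \<open>6*m/20\<close>, within \<open>9*m/20\<close>. This coefficient matches the lower bound
    \<open>9/20 * (m * h)\<close> for \<open>b\<close> below, so the quotient is exactly
    \<open>\<eta> / h\<close>.\<close>
  define E where "E = \<eta> * (9 / 20 * real m)"
  have E: "\<eta> * (2 * \<rho> * loglog + real m * \<eta> + 3 / 10 * real m) \<le> E" if "\<rho> \<le> 1" "\<rho> > 0" for \<rho>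
  proof -
    have "\<rho> * loglog \<le> real m / 40" using mult_right_mono[OF that(1) ll0] ll(1) by simp
    moreover have "real m * \<eta> \<le> real m * (1 / 20)" using \<eta> by (intro mult_left_mono) auto
    ultimately show ?thesis unfolding E_def using \<eta> by (intro mult_left_mono) auto
  qed
  have \<eta>1: "\<eta> \<le> 1" using \<eta> by simp
  have a: "a \<le> a'" "a' \<le> a + E"
    using binned_f_bounds[OF G _ \<eta>(1) \<eta>1, of 1] E[of 1] by (auto simp: a_def a'_def)
  have b: "b \<le> b'" "b' \<le> b + E"
    using binned_f_bounds[OF G _ \<eta>(1) \<eta>1, of "1/2"] E[of "1/2"] by (auto simp: b_def b'_def)
  have "b \<ge> 1/2 * (real m * h - loglog)"
    using guess_f_lower[OF bij \<open>m \<ge> 1\<close>, of "1/2"] by (simp add: b_def h_def)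
  moreover have "loglog \<le> 1 / 10 * (real m * h)"
    using ll(2) mult_right_mono[OF g(2), of "real m / 10"] by (simp add: h_def mult.commute)
  ultimately have b_low: "9 / 20 * (real m * h) \<le> b" by simp
  have bpos: "b > 0" "b' > 0"
    using b_low b(1) mult_pos_pos[OF m h] by auto
  define s where "s = a / b"
  have s: "s \<ge> 0" using guess_f_nonneg[OF bij, of 1] bpos by (simp add: s_def a_def)
  have "a' / b' - s = ((a' - a) - s * (b' - b)) / b'"
    using bpos by (simp add: s_def field_simps)
  also have "\<bar>\<dots>\<bar> \<le> (E + s * E) / b'"
  proof -
    have "0 \<le> s * (b' - b)" "s * (b' - b) \<le> s * E" using s b by (auto intro: mult_left_mono)
    moreover have "E \<ge> 0" "s * E \<ge> 0" using a s by (auto intro: mult_nonneg_nonneg)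
    ultimately have "\<bar>(a' - a) - s * (b' - b)\<bar> \<le> E + s * E" using a by linarith
    then show ?thesis using bpos by (simp add: divide_right_mono)
  qed
  also have "\<dots> = (1 + s) * E / b'" by (simp add: algebra_simps)
  also have "\<dots> \<le> (1 + s) * E / (9 / 20 * (real m * h))"
    using b_low b(1) bpos s a m h by (intro divide_left_mono mult_nonneg_nonneg mult_pos_pos) auto
  also have "\<dots> = (1 + s) / h * \<eta>" using m h by (simp add: E_def field_simps)
  also have "\<dots> \<le> (2 + s) / h * \<eta>"
    using h \<eta> by (intro mult_right_mono divide_right_mono) auto
  finally show ?thesis
    by (simp add: binned_s_def guess_s_def a_def b_def a'_def b'_def s_def h_def)
qed

section \<open>Nonnegativity of the local-CLT term\<close>

lemma lclt_eps_nonneg: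
  assumes "\<eta> > 0" shows "lclt_eps m A p \<eta> \<tau> \<ge> 0"
proof -
  have \<beta>: "third_moment m A p \<eta> \<tau> \<ge> 0"
    unfolding third_moment_def by (intro sum_nonneg integral_nonneg_AE) auto
  have \<sigma>: "total_sd m A p \<eta> \<tau> \<ge> 0"
    unfolding total_sd_def by (intro real_sqrt_ge_zero sum_nonneg) auto
  have Q: "lclt_Q m A p \<eta> \<tau> t \<ge> 0" for t
    unfolding lclt_Q_def by (intro sum_nonneg) auto
  \<comment> \<open>For a non-integrable function \<open>integral\<close> has the default value 0,
    so the sign holds in either case.\<close>
  have I: "integral U f \<ge> 0" if "\<And>t. f t \<ge> 0" for f :: "real \<Rightarrow> real" and U
    using that by (cases "f integrable_on U") (auto intro: Henstock_Kurzweil_Integration.integral_nonneg simp: not_integrable_integral)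
  have "lclt_q m A p \<eta> \<tau> \<ge> 0"
    unfolding lclt_q_def Let_def using \<beta> \<sigma> Q by (intro mult_nonneg_nonneg I add_nonneg_nonneg) auto
  then show ?thesis
    unfolding lclt_eps_def normal_tail_def exp_neg_half_def using \<beta> \<sigma> assms
    by (intro add_nonneg_nonneg mult_nonneg_nonneg divide_nonneg_nonneg) auto
qed

text \<open>The bound on the extended-real supremum makes the family bounded above, so that the real
  \<open>SUP\<close> is a genuine supremum and dominates the value at
  \<open>\<tau> = 0\<close>.\<close>

lemma lclt_eps_sup_nonneg:
  assumes "\<eta> > 0" and le: "(SUP \<tau>\<in>{-1..0}. ereal (sqrt (2 * pi) * lclt_eps m A p \<eta> \<tau>)) \<le> ereal c\<^sub>0"
  shows "lclt_eps_sup m A p \<eta> \<ge> 0"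
proof -
  have "sqrt (2 * pi) * lclt_eps m A p \<eta> \<tau> \<le> c\<^sub>0" if "\<tau> \<in> {-1..0}" for \<tau>
    using le that by (auto simp: SUP_le_iff)
  then have "lclt_eps m A p \<eta> \<tau> \<le> c\<^sub>0 / sqrt (2 * pi)" if "\<tau> \<in> {-1..0}" for \<tau>
    using that by (simp add: pos_le_divide_eq mult.commute)
  then have "bdd_above (lclt_eps m A p \<eta> ` {-1..0})" by (intro bdd_aboveI2)
  then have "lclt_eps m A p \<eta> 0 \<le> lclt_eps_sup m A p \<eta>"
    unfolding lclt_eps_sup_def by (intro cSUP_upper) auto
  then show ?thesis using lclt_eps_nonneg[OF assms(1), of 0] by linarith
qed

end

subsection \<open>The saddle term\<close>

text \<open>The two derivatives of a log-moment generating function are the mean and variance of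
  \<open>a\<close> under the tilted law; the variance is positive when \<open>a\<close> is not
  constant.\<close>

lemma log_mgf_derivs:
  fixes a :: "'b \<Rightarrow> real" and n :: real
  assumes fin: "finite K" "K \<noteq> {}" and "n > 0"
  defines "M \<equiv> \<lambda>\<tau>. \<Sum>x\<in>K. exp (\<tau> * a x)" and "M1 \<equiv> \<lambda>\<tau>. \<Sum>x\<in>K. a x * exp (\<tau> * a x)"
    and "M2 \<equiv> \<lambda>\<tau>. \<Sum>x\<in>K. (a x)\<^sup>2 * exp (\<tau> * a x)"
  shows "((\<lambda>\<tau>. ln (M \<tau> / n)) has_real_derivative M1 \<tau> / M \<tau>) (at \<tau>)"
    and "((\<lambda>\<tau>. M1 \<tau> / M \<tau>) has_real_derivative (M2 \<tau> * M \<tau> - (M1 \<tau>)\<^sup>2) / (M \<tau>)\<^sup>2) (at \<tau>)"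
    and "\<not> (\<exists>c. \<forall>x\<in>K. a x = c) \<Longrightarrow> (M2 \<tau> * M \<tau> - (M1 \<tau>)\<^sup>2) / (M \<tau>)\<^sup>2 > 0"
proof -
  have M: "M \<tau> > 0" for \<tau> unfolding M_def using fin by (intro sum_pos) auto
  have dM: "(M has_real_derivative M1 \<tau>) (at \<tau>)" for \<tau>
    unfolding M_def M1_def by (auto intro!: derivative_eq_intros sum.cong)
  have dM1: "(M1 has_real_derivative M2 \<tau>) (at \<tau>)" for \<tau>
    unfolding M1_def M2_def by (auto intro!: derivative_eq_intros sum.cong simp: power2_eq_square)
  show "((\<lambda>\<tau>. ln (M \<tau> / n)) has_real_derivative M1 \<tau> / M \<tau>) (at \<tau>)"
    using M[of \<tau>] \<open>n > 0\<close> by (auto intro!: derivative_eq_intros dM simp: field_simps)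
  show "((\<lambda>\<tau>. M1 \<tau> / M \<tau>) has_real_derivative (M2 \<tau> * M \<tau> - (M1 \<tau>)\<^sup>2) / (M \<tau>)\<^sup>2) (at \<tau>)"
    using M[of \<tau>] by (auto intro!: derivative_eq_intros dM dM1 simp: power2_eq_square)
  assume nc: "\<not> (\<exists>c. \<forall>x\<in>K. a x = c)"
  define \<mu> where "\<mu> = M1 \<tau> / M \<tau>"
  obtain x\<^sub>0 where x0: "x\<^sub>0 \<in> K" "a x\<^sub>0 \<noteq> \<mu>" using nc by blast
  \<comment> \<open>Unnormalised tilted variance, with \<open>\<mu>\<close> the tilted mean; the
    term at \<open>x\<^sub>0\<close> is positive.\<close>
  have "0 < (\<Sum>x\<in>K. (a x - \<mu>)\<^sup>2 * exp (\<tau> * a x))"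
    using x0 fin by (intro sum_pos2[of K x\<^sub>0]) auto
  also have "\<dots> = M2 \<tau> - 2 * \<mu> * M1 \<tau> + \<mu>\<^sup>2 * M \<tau>"
    by (simp add: M_def M1_def M2_def power2_diff sum_subtractf sum.distrib sum_distrib_left algebra_simps)
  also have "\<dots> = (M2 \<tau> * M \<tau> - (M1 \<tau>)\<^sup>2) / M \<tau>"
    using M[of \<tau>] by (simp add: \<mu>_def field_simps power2_eq_square)
  finally show "(M2 \<tau> * M \<tau> - (M1 \<tau>)\<^sup>2) / (M \<tau>)\<^sup>2 > 0"
    using M[of \<tau>] by (simp add: zero_less_divide_iff)
qed

context key_model
begin

lemma surprisal_nonconstant:
  assumes "measure_pmf.variance (key_unif m A) S > 0"
  shows "\<not> (\<exists>c. \<forall>x\<in>K. S x = c)"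
proof
  assume "\<exists>c. \<forall>x\<in>K. S x = c"
  then obtain c where c: "\<And>x. x \<in> K \<Longrightarrow> S x = c" by blast
  have "measure_pmf.expectation (key_unif m A) S = c"
    unfolding key_unif_def using finite_keys keys_nonempty c by (simp add: integral_pmf_of_set)
  then have "measure_pmf.variance (key_unif m A) S = 0"
    unfolding key_unif_def using finite_keys keys_nonempty c by (simp add: integral_pmf_of_set)
  then show False using assms by simp
qed

text \<open>
  A real \<open>Sup\<close> of an unbounded set is unspecified, so the bound below needs the saddle range to
  be compact and \<open>\<Lambda>\<^sub>U''\<close> to stay away from \<open>0\<close> on it.
\<close>

lemma zbar_inv_sq_nonneg:
  assumes var: "measure_pmf.variance (key_unif m A) S > 0" and "\<tau>\<^sub>0 > 0"
  shows "zbar_inv_sq m A p \<tau>\<^sub>0 \<ge> 0"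
proof -
  define M M1 M2 where "M \<tau> = (\<Sum>x\<in>K. exp (\<tau> * S x))" and "M1 \<tau> = (\<Sum>x\<in>K. S x * exp (\<tau> * S x))"
    and "M2 \<tau> = (\<Sum>x\<in>K. (S x)\<^sup>2 * exp (\<tau> * S x))" for \<tau>
  define k1 where "k1 \<tau> = M1 \<tau> / M \<tau>" for \<tau>
  define k2 where "k2 \<tau> = (M2 \<tau> * M \<tau> - (M1 \<tau>)\<^sup>2) / (M \<tau>)\<^sup>2" for \<tau>
  have cgf: "unif_cgf m A p = (\<lambda>\<tau>. ln (M \<tau> / N))"
    unfolding unif_cgf_def key_unif_def M_def using finite_keys keys_nonempty by (simp add: integral_pmf_of_set)
  have N: "N > 0" using N_ge_1 by simp
  note D = log_mgf_derivs[OF finite_keys keys_nonempty N, of S, folded M_def M1_def M2_def]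
  have d1: "deriv (unif_cgf m A p) = k1"
  proof
    show "deriv (unif_cgf m A p) \<tau> = k1 \<tau>" for \<tau>
      unfolding cgf k1_def by (rule DERIV_imp_deriv[OF D(1)])
  qed
  have d2: "(k1 has_real_derivative k2 \<tau>) (at \<tau>)" for \<tau>
    unfolding k1_def[abs_def] k2_def by (rule D(2))
  then have dd: "deriv (deriv (unif_cgf m A p)) = k2"
    unfolding d1 using DERIV_imp_deriv by blast
  have k2: "k2 \<tau> > 0" for \<tau>
    unfolding k2_def by (rule D(3)[OF surprisal_nonconstant[OF var]])
  \<comment> \<open>Tilting the uniform law by \<open>- 1\<close> gives the key law, so
    \<open>t \<ge> H\<close> becomes \<open>\<tau> \<ge> - 1\<close> by monotonicity of
    \<open>k1\<close>.\<close>
  have mean: "mean_surprisal m p = k1 (- 1)"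
    using sum_exp_neg_surprisal
    by (simp add: mean_surprisal_def expectation_key_law k1_def M1_def M_def mult.commute)
  have ge: "- 1 \<le> \<tau>" if "k1 (- 1) \<le> k1 \<tau>" for \<tau>
  proof (rule ccontr)
    assume "\<not> - 1 \<le> \<tau>"
    then have "\<tau> < - 1" by simp
    then have "k1 \<tau> < k1 (- 1)" by (rule DERIV_pos_imp_increasing) (use d2 k2 in blast)
    then show False using that by simp
  qed
  have M0: "M \<tau> \<noteq> 0" for \<tau>
    using finite_keys keys_nonempty sum_pos[of K "\<lambda>x. exp (\<tau> * S x)"] unfolding M_def by force
  have "continuous_on {-1..0} k2"
    unfolding k2_def using M0 unfolding M_def M1_def M2_def by (intro continuous_intros) auto
  then obtain \<tau>' where \<tau>': "\<forall>\<tau>\<in>{-1..0}. k2 \<tau>' \<le> k2 \<tau>"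
    using continuous_attains_inf[of "{-1..0::real}" k2] by auto
  let ?X = "{1 / (saddle_z m A p \<tau>)\<^sup>2 | t \<tau>.
        deriv (unif_cgf m A p) \<tau> = t \<and> mean_surprisal m p \<le> t \<and> \<tau>\<^sub>0 \<le> \<bar>\<tau>\<bar> \<and> \<tau> \<le> 0}"
  have "z \<le> 1 / (\<tau>\<^sub>0\<^sup>2 * k2 \<tau>')" if zX: "z \<in> ?X" for z
  proof -
    obtain \<tau> where z: "z = 1 / (saddle_z m A p \<tau>)\<^sup>2" and \<tau>: "k1 (- 1) \<le> k1 \<tau>" "\<tau>\<^sub>0 \<le> \<bar>\<tau>\<bar>" "\<tau> \<le> 0"
      using zX unfolding d1 mean by blast
    \<comment> \<open>On the saddle range both factors of the squared \<open>saddle_z\<close> are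
      bounded below: by the threshold, and by the minimum of \<open>k2\<close> on
      \<open>[-1, 0]\<close>.\<close>
    have "\<tau>\<^sub>0\<^sup>2 * k2 \<tau>' \<le> \<bar>\<tau>\<bar>\<^sup>2 * k2 \<tau>"
      using ge[OF \<tau>(1)] \<tau> \<tau>' k2[of \<tau>'] \<open>\<tau>\<^sub>0 > 0\<close> by (intro mult_mono power_mono) auto
    also have "\<dots> = (saddle_z m A p \<tau>)\<^sup>2"
      using k2[of \<tau>] by (simp add: saddle_z_def dd power_mult_distrib)
    finally have le: "\<tau>\<^sub>0\<^sup>2 * k2 \<tau>' \<le> (saddle_z m A p \<tau>)\<^sup>2" .
    have "0 < \<tau>\<^sub>0\<^sup>2 * k2 \<tau>'" using k2[of \<tau>'] \<open>\<tau>\<^sub>0 > 0\<close> by simp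
    then show ?thesis unfolding z using le by (intro frac_le) auto
  qed
  then have "bdd_above (insert 0 ?X)" unfolding bdd_above_insert by (auto intro!: bdd_aboveI)
  then show ?thesis unfolding zbar_inv_sq_def by (intro cSup_upper) simp_all
qed

end

section \<open>From estimates at fixed \<open>m\<close> to the asymptotic statement\<close>

theorem theorem6p7:
  "\<exists>C::real. C \<ge> 0 \<and>
   (\<forall>(m\<^sub>0::nat) (A :: nat \<Rightarrow> nat \<Rightarrow> 'a set) (p :: nat \<Rightarrow> nat \<Rightarrow> 'a pmf)
     (G :: nat \<Rightarrow> (nat \<Rightarrow> 'a) \<Rightarrow> nat) (\<eta> :: nat \<Rightarrow> real)
     (\<epsilon>\<^sub>0::real) (l::real) (g::real) (c\<^sub>0::real) (\<tau>\<^sub>0::real).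
     m\<^sub>0 \<ge> 1 \<and> \<epsilon>\<^sub>0 > 0 \<and> l > 0 \<and> g > 0 \<and> c\<^sub>0 < 1 \<and> \<tau>\<^sub>0 > 0 \<and>
     (\<forall>m\<ge>m\<^sub>0. \<forall>i\<in>{1..m}. finite (A m i) \<and> set_pmf (p m i) \<subseteq> A m i \<and>
                           (\<forall>a\<in>A m i. pmf (p m i) a > 0)) \<and>
     (\<forall>m\<ge>m\<^sub>0. measure_pmf.variance (key_unif m (A m)) (total_surprisal m (p m)) > 0) \<and>
     (\<forall>m\<ge>m\<^sub>0. guess_order m (A m) (p m) (G m)) \<and>
     (\<forall>m\<ge>m\<^sub>0. \<eta> m > 0 \<and> sqrt (real m) * \<eta> m \<le> \<epsilon>\<^sub>0) \<and>
     (\<forall>m\<ge>m\<^sub>0. (INF \<tau>\<in>{-1..0}. span_Lambda m (A m) (p m) (\<eta> m) \<tau>) \<ge> ereal (l * real m)) \<and>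
     (\<forall>m\<ge>m\<^sub>0. \<forall>\<rho>\<in>{1/2..1}.
        mean_renyi m (A m) (p m) (1 / (1 + \<rho>)) - mean_renyi m (A m) (p m) 1 \<ge> g) \<and>
     (\<lambda>m. ln (1 + ln (real (card (keys m (A m)))))) \<in> o(\<lambda>m. real m) \<and>
     (\<forall>m\<ge>m\<^sub>0. (SUP \<tau>\<in>{-1..0}. ereal (sqrt (2 * pi) * lclt_eps m (A m) (p m) (\<eta> m) \<tau>))
                \<le> ereal c\<^sub>0)
     \<longrightarrow>
     (\<exists>\<epsilon> :: nat \<Rightarrow> real.
        (\<forall>m\<ge>m\<^sub>0. \<bar>binned_s m (A m) (p m) (\<eta> m) - guess_s m (p m) (G m)\<bar>
            \<le> (2 + guess_s m (p m) (G m)) / mean_renyi m (A m) (p m) (2/3) * \<eta> m * (1 + \<epsilon> m)) \<and>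
        (\<forall>\<^sub>F m in sequentially.
            \<epsilon> m \<le> 2 * sqrt (2 * pi) * lclt_eps_sup m (A m) (p m) (\<eta> m) *
                     (1 + C * lclt_eps_sup m (A m) (p m) (\<eta> m))
                   + zbar_inv_sq m (A m) (p m) \<tau>\<^sub>0
                   + C * \<eta> m
                   + C * (ln (1 + ln (real (card (keys m (A m))))) / binned_f m (A m) (p m) (\<eta> m) (1/2))) \<and>
        ((\<exists>c. \<forall>m\<ge>m\<^sub>0. \<forall>i\<in>{1..m}. surprisal_spread (A m) (p m) i \<le> c) \<and>
         (\<lambda>m. \<Sum>i=1..m. surprisal_spread (A m) (p m) i) \<in> \<Theta>(\<lambda>m. real m) \<and>
         (\<lambda>m. ln (1 / \<eta> m)) \<in> o(\<lambda>m. real m)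
         \<longrightarrow> \<epsilon> \<in> O(\<lambda>m. real m powr (-1/2)))))"
proof (intro exI[of _ 0] conjI allI impI)
  \<comment> \<open>The witness for \<open>C\<close> is 0: eventually
    \<open>\<epsilon> m = 0\<close>, and the summands that remain are nonnegative.\<close>
  fix m\<^sub>0 :: nat and A :: "nat \<Rightarrow> nat \<Rightarrow> 'a set" and p :: "nat \<Rightarrow> nat \<Rightarrow> 'a pmf"
    and G :: "nat \<Rightarrow> (nat \<Rightarrow> 'a) \<Rightarrow> nat" and \<eta> :: "nat \<Rightarrow> real" and \<epsilon>\<^sub>0 l g c\<^sub>0 \<tau>\<^sub>0 :: real
  let ?ll = "\<lambda>m. ln (1 + ln (real (card (keys m (A m)))))"
  assume hyps: "m\<^sub>0 \<ge> 1 \<and> \<epsilon>\<^sub>0 > 0 \<and> l > 0 \<and> g > 0 \<and> c\<^sub>0 < 1 \<and> \<tau>\<^sub>0 > 0 \<and>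
     (\<forall>m\<ge>m\<^sub>0. \<forall>i\<in>{1..m}. finite (A m i) \<and> set_pmf (p m i) \<subseteq> A m i \<and>
                           (\<forall>a\<in>A m i. pmf (p m i) a > 0)) \<and>
     (\<forall>m\<ge>m\<^sub>0. measure_pmf.variance (key_unif m (A m)) (total_surprisal m (p m)) > 0) \<and>
     (\<forall>m\<ge>m\<^sub>0. guess_order m (A m) (p m) (G m)) \<and>
     (\<forall>m\<ge>m\<^sub>0. \<eta> m > 0 \<and> sqrt (real m) * \<eta> m \<le> \<epsilon>\<^sub>0) \<and>
     (\<forall>m\<ge>m\<^sub>0. (INF \<tau>\<in>{-1..0}. span_Lambda m (A m) (p m) (\<eta> m) \<tau>) \<ge> ereal (l * real m)) \<and>
     (\<forall>m\<ge>m\<^sub>0. \<forall>\<rho>\<in>{1/2..1}.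
        mean_renyi m (A m) (p m) (1 / (1 + \<rho>)) - mean_renyi m (A m) (p m) 1 \<ge> g) \<and>
     (\<lambda>m. ln (1 + ln (real (card (keys m (A m)))))) \<in> o(\<lambda>m. real m) \<and>
     (\<forall>m\<ge>m\<^sub>0. (SUP \<tau>\<in>{-1..0}. ereal (sqrt (2 * pi) * lclt_eps m (A m) (p m) (\<eta> m) \<tau>))
                \<le> ereal c\<^sub>0)"
  then have m0: "m\<^sub>0 \<ge> 1" and \<epsilon>0: "\<epsilon>\<^sub>0 > 0" and g: "g > 0" and \<tau>0: "\<tau>\<^sub>0 > 0"
    and o: "?ll \<in> o(\<lambda>m. real m)" by blast+
  have model: "key_model m (A m) (p m)" if "m \<ge> m\<^sub>0" for m
    using hyps that by (intro key_model.intro) blast+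
  have var: "measure_pmf.variance (key_unif m (A m)) (total_surprisal m (p m)) > 0"
    and G: "guessing_order (keys m (A m)) (total_surprisal m (p m)) (G m)"
    and \<eta>: "\<eta> m > 0" "sqrt (real m) * \<eta> m \<le> \<epsilon>\<^sub>0"
    and c0: "(SUP \<tau>\<in>{-1..0}. ereal (sqrt (2 * pi) * lclt_eps m (A m) (p m) (\<eta> m) \<tau>)) \<le> ereal c\<^sub>0"
    if "m \<ge> m\<^sub>0" for m
    using hyps that key_model.guess_order_iff[OF model[OF that]] by blast+
  have renyi: "mean_renyi m (A m) (p m) (2/3) \<ge> g" if "m \<ge> m\<^sub>0" for m
  proof -
    \<comment> \<open>The entropy gap at \<open>\<rho> = 1/2\<close>, together with a nonnegative
      Shannon entropy, bounds the order-2/3 entropy below by \<open>g\<close>.\<close>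
    have "mean_renyi m (A m) (p m) (1 / (1 + 1/2)) - mean_renyi m (A m) (p m) 1 \<ge> g"
      using hyps that by (elim conjE allE[of _ m] impE ballE[of _ _ "1/2"]) auto
    then show ?thesis using key_model.mean_renyi_1_nonneg[OF model[OF that]] by simp
  qed
  define s h where "s m = guess_s m (p m) (G m)" and "h m = mean_renyi m (A m) (p m) (2/3)" for m
  define d where "d m = \<bar>binned_s m (A m) (p m) (\<eta> m) - s m\<bar>" for m
  \<comment> \<open>The least nonnegative correction for which the bound holds; at small
    \<open>m\<close> it absorbs whatever error occurs.\<close>
  define \<epsilon> where "\<epsilon> m = max 0 (d m / ((2 + s m) / h m * \<eta> m) - 1)" for m
  have s: "s m \<ge> 0" if "m \<ge> m\<^sub>0" for m
    using key_model.guess_f_nonneg[OF model[OF that]] G[OF that]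
    by (simp add: s_def guess_s_def guessing_order_def)
  have scale: "(2 + s m) / h m * \<eta> m > 0" if "m \<ge> m\<^sub>0" for m
    using s[OF that] renyi[OF that] g \<eta>[OF that] by (simp add: h_def)

  have "\<forall>\<^sub>F m in sequentially. ?ll m \<le> real m / 40"
    using landau_o.smallD[OF o, of "1/40"] by (rule eventually_mono) auto
  moreover have "\<forall>\<^sub>F m in sequentially. ?ll m \<le> g / 10 * real m"
    using landau_o.smallD[OF o, of "g/10"] g by (auto elim!: eventually_mono)
  \<comment> \<open>From here on \<open>sqrt m * \<eta> m \<le> \<epsilon>\<^sub>0\<close> forces
    \<open>\<eta> m \<le> 1 / 20\<close>.\<close>
  moreover have "\<forall>\<^sub>F m in sequentially. real m \<ge> (20 * \<epsilon>\<^sub>0)\<^sup>2"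
    by (rule eventually_ge_at_top[THEN filterlim_real_sequentially[unfolded filterlim_iff, rule_format]])
  ultimately have ev: "\<forall>\<^sub>F m in sequentially. m \<ge> m\<^sub>0 \<and> \<epsilon> m = 0"
    using eventually_ge_at_top[of m\<^sub>0]
  proof eventually_elim
    case (elim m)
    have "20 * \<epsilon>\<^sub>0 \<le> sqrt (real m)" using elim(3) \<epsilon>0 by (simp add: real_le_rsqrt)
    then have "20 * \<epsilon>\<^sub>0 * \<eta> m \<le> \<epsilon>\<^sub>0"
      using \<eta>[OF elim(4)] by (meson order_trans mult_right_mono less_imp_le)
    then have "\<eta> m \<le> 1 / 20" using \<epsilon>0 by simp
    then have "d m \<le> (2 + s m) / h m * \<eta> m"
      unfolding d_def s_def h_def using elim m0 \<eta>[OF elim(4)] g renyi[OF elim(4)]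
      by (intro key_model.binned_s_error[OF model[OF elim(4)] G[OF elim(4)]]) auto
    then have "d m / ((2 + s m) / h m * \<eta> m) \<le> 1"
      using scale[OF elim(4)] by (simp only: pos_divide_le_eq mult_1)
    then have "\<epsilon> m = 0" unfolding \<epsilon>_def by (intro max_absorb1) linarith
    then show ?case using elim(4) by simp
  qed

  show "\<exists>\<epsilon> :: nat \<Rightarrow> real.
        (\<forall>m\<ge>m\<^sub>0. \<bar>binned_s m (A m) (p m) (\<eta> m) - guess_s m (p m) (G m)\<bar>
            \<le> (2 + guess_s m (p m) (G m)) / mean_renyi m (A m) (p m) (2/3) * \<eta> m * (1 + \<epsilon> m)) \<and>
        (\<forall>\<^sub>F m in sequentially.
            \<epsilon> m \<le> 2 * sqrt (2 * pi) * lclt_eps_sup m (A m) (p m) (\<eta> m) *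
                     (1 + 0 * lclt_eps_sup m (A m) (p m) (\<eta> m))
                   + zbar_inv_sq m (A m) (p m) \<tau>\<^sub>0
                   + 0 * \<eta> m
                   + 0 * (?ll m / binned_f m (A m) (p m) (\<eta> m) (1/2))) \<and>
        ((\<exists>c. \<forall>m\<ge>m\<^sub>0. \<forall>i\<in>{1..m}. surprisal_spread (A m) (p m) i \<le> c) \<and>
         (\<lambda>m. \<Sum>i=1..m. surprisal_spread (A m) (p m) i) \<in> \<Theta>(\<lambda>m. real m) \<and>
         (\<lambda>m. ln (1 / \<eta> m)) \<in> o(\<lambda>m. real m)
         \<longrightarrow> \<epsilon> \<in> O(\<lambda>m. real m powr (-1/2)))"
  proof (intro exI[of _ \<epsilon>] conjI allI impI)
    fix m assume m: "m \<ge> m\<^sub>0"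
    have "d m / ((2 + s m) / h m * \<eta> m) \<le> 1 + \<epsilon> m" by (simp add: \<epsilon>_def)
    then have "d m \<le> (2 + s m) / h m * \<eta> m * (1 + \<epsilon> m)"
      using scale[OF m] by (simp only: pos_divide_le_eq mult.commute)
    then show "\<bar>binned_s m (A m) (p m) (\<eta> m) - guess_s m (p m) (G m)\<bar>
            \<le> (2 + guess_s m (p m) (G m)) / mean_renyi m (A m) (p m) (2/3) * \<eta> m * (1 + \<epsilon> m)"
      by (simp only: d_def s_def h_def)
  next
    show "\<forall>\<^sub>F m in sequentially.
            \<epsilon> m \<le> 2 * sqrt (2 * pi) * lclt_eps_sup m (A m) (p m) (\<eta> m) *
                     (1 + 0 * lclt_eps_sup m (A m) (p m) (\<eta> m))
                   + zbar_inv_sq m (A m) (p m) \<tau>\<^sub>0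
                   + 0 * \<eta> m
                   + 0 * (?ll m / binned_f m (A m) (p m) (\<eta> m) (1/2))"
      using ev
    proof eventually_elim
      case (elim m)
      then have m: "m \<ge> m\<^sub>0" by simp
      show ?case
        using key_model.lclt_eps_sup_nonneg[OF model[OF m] \<eta>(1)[OF m] c0[OF m]]
          key_model.zbar_inv_sq_nonneg[OF model[OF m] var[OF m] \<tau>0] elim by simp
    qed
  next
    show "\<epsilon> \<in> O(\<lambda>m. real m powr (-1/2))"
      using ev by (intro bigoI[of _ 0]) (auto elim: eventually_mono)
  qed
qed simp

end
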